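(* Let $a_0\in\mathbb{D}$, $a_1,b\in\mathbb{C}$, $\psi(z)=\frac{b}{1-a_0z}$ and $\varphi(z)=a_0+\frac{a_1z}{1-a_0z}$, where $\varphi$ is an analytic self-map of $\mathbb{D}$. Let $p\in\mathbb{D}\setminus\{0\}$, $|c|=1$, $\varphi_p(z)=\frac{\overline{p}}{p}\frac{p-z}{1-\overline{p}z}$, $\psi_p(z)=c\frac{(1-|p|^2)^{1/2}}{1-\overline{p}z}$, and put $\widetilde\psi=\psi_p\cdot(\psi\circ\varphi_p)$, $\widetilde\varphi=\varphi\circ\varphi_p$. If $C_{\widetilde\psi,\widetilde\varphi}$ is compact or power compact on $H^2$, then $$r(C_{\widetilde\psi,\widetilde\varphi})=|\psi_p(w)\psi(\varphi_p(w))|$$ and $$\sigma(C_{\widetilde\psi,\widetilde\varphi})=\{\psi_p(w)\psi(\varphi_p(w))(\widetilde\varphi'(w))^m : m=0,1,\dots\}\cup\{0\},$$ where $w$ is the Denjoy-Wolff point of $\widetilde\varphi$.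
   Context: $\mathbb{D}$ is the open unit disk and $H^2$ is the Hardy space on $\mathbb{D}$. $(C_{\psi,\varphi}f)(z)=\psi(z)f(\varphi(z))$ is the weighted composition operator. $\sigma(T)$ and $r(T)$ denote the spectrum and spectral radius of a bounded operator $T$; $T$ is power compact if some power $T^n$, $n\ge1$, is compact. For an analytic self-map of $\mathbb{D}$ that is neither the identity nor an elliptic automorphism (an automorphism with a fixed point in $\mathbb{D}$), the Denjoy-Wolff point is the unique $w\in\overline{\mathbb{D}}$ to which the iterates converge uniformly on compact subsets of $\mathbb{D}$. *)

theory Defs
  imports "HOL-Analysis.Analysis"
begin

text \<open>HOL-Analysis only has real normed spaces. A complex normed space is a real one with a
  compatible complex scalar multiplication.\<close>

class complex_normed_vector = real_normed_vector +
  fixes scaleC :: "complex \<Rightarrow> 'a \<Rightarrow> 'a"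
  assumes scaleC_add_right: "scaleC a (x + y) = scaleC a x + scaleC a y"
    and scaleC_add_left: "scaleC (a + b) x = scaleC a x + scaleC b x"
    and scaleC_scaleC: "scaleC a (scaleC b x) = scaleC (a * b) x"
    and scaleC_of_real: "scaleC (complex_of_real r) x = scaleR r x"
    and norm_scaleC: "norm (scaleC a x) = cmod a * norm x"

definition bounded_clinear ::
    "('a::complex_normed_vector \<Rightarrow> 'b::complex_normed_vector) \<Rightarrow> bool" where
  "bounded_clinear T \<longleftrightarrow> bounded_linear T \<and> (\<forall>c x. T (scaleC c x) = scaleC c (T x))"

definition compact_operator ::
    "('a::complex_normed_vector \<Rightarrow> 'b::complex_normed_vector) \<Rightarrow> bool" where
  "compact_operator T \<longleftrightarrow> bounded_clinear T \<and> compact (closure (T ` cball 0 1))"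

definition power_compact_operator :: "('a::complex_normed_vector \<Rightarrow> 'a) \<Rightarrow> bool" where
  "power_compact_operator T \<longleftrightarrow> (\<exists>n\<ge>1. compact_operator (T ^^ n))"

definition invertible_operator :: "('a::complex_normed_vector \<Rightarrow> 'a) \<Rightarrow> bool" where
  "invertible_operator T \<longleftrightarrow> (\<exists>S. bounded_clinear S \<and> S \<circ> T = id \<and> T \<circ> S = id)"

definition operator_spectrum :: "('a::complex_normed_vector \<Rightarrow> 'a) \<Rightarrow> complex set" where
  "operator_spectrum T = {\<mu>. \<not> invertible_operator (\<lambda>x. T x - scaleC \<mu> x)}"

definition operator_spectral_radius :: "('a::complex_normed_vector \<Rightarrow> 'a) \<Rightarrow> real" where
  "operator_spectral_radius T = (SUP \<mu>\<in>operator_spectrum T. cmod \<mu>)"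

definition hardy_mean :: "(complex \<Rightarrow> complex) \<Rightarrow> real \<Rightarrow> real" where
  "hardy_mean f r =
    (1 / (2 * pi)) * integral {0..2 * pi} (\<lambda>t. (cmod (f (complex_of_real r * cis t)))\<^sup>2)"

text \<open>An analytic function on the disk is represented by its extension by zero to the whole plane,
  so that equality of functions on the disk becomes equality in the type.\<close>

definition hardy_set :: "(complex \<Rightarrow> complex) set" where
  "hardy_set = {f. f holomorphic_on ball 0 1 \<and> (\<forall>z. z \<notin> ball 0 1 \<longrightarrow> f z = 0) \<and>
     bdd_above (hardy_mean f ` {0<..<1})}"

lemma hardy_mean_integrable:
  assumes "f holomorphic_on ball 0 1" "0 < r" "r < 1"
  shows "continuous_on {0..2 * pi} (\<lambda>t. (cmod (f (complex_of_real r * cis t)))\<^sup>2)"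
    and "(\<lambda>t. (cmod (f (complex_of_real r * cis t)))\<^sup>2) integrable_on {0..2 * pi}"
proof -
  have c: "continuous_on (ball 0 1) f"
    using assms(1) by (rule holomorphic_on_imp_continuous_on)
  have "continuous_on {0..2 * pi} (\<lambda>t. f (complex_of_real r * cis t))"
    by (rule continuous_on_compose2[OF c])
      (use assms in \<open>auto intro!: continuous_intros simp: norm_mult\<close>)
  then show "continuous_on {0..2 * pi} (\<lambda>t. (cmod (f (complex_of_real r * cis t)))\<^sup>2)"
    by (intro continuous_intros)
  then show "(\<lambda>t. (cmod (f (complex_of_real r * cis t)))\<^sup>2) integrable_on {0..2 * pi}"
    by (rule integrable_continuous_real)
qed

lemma hardy_mean_nonneg: "0 \<le> hardy_mean f r"
proof (cases "(\<lambda>t. (cmod (f (complex_of_real r * cis t)))\<^sup>2) integrable_on {0..2 * pi}")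
  case True
  then have "0 \<le> integral {0..2 * pi} (\<lambda>t. (cmod (f (complex_of_real r * cis t)))\<^sup>2)"
    by (rule Henstock_Kurzweil_Integration.integral_nonneg) simp
  then show ?thesis by (simp add: hardy_mean_def)
qed (simp add: hardy_mean_def not_integrable_integral)

lemma cmod_add_power2_le:
  assumes "0 < (s::real)"
  shows "(cmod (x + y))\<^sup>2 \<le> (1 + s) * (cmod x)\<^sup>2 + (1 + 1 / s) * (cmod y)\<^sup>2"
proof -
  have "(cmod (x + y))\<^sup>2 \<le> (cmod x + cmod y)\<^sup>2"
    by (simp add: norm_triangle_ineq power_mono)
  also have "\<dots> = (cmod x)\<^sup>2 + (cmod y)\<^sup>2 + 2 * cmod x * cmod y"
    by (simp add: power2_sum)
  also have "2 * cmod x * cmod y \<le> s * (cmod x)\<^sup>2 + (1 / s) * (cmod y)\<^sup>2"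
  proof -
    have "0 \<le> (s * cmod x - cmod y)\<^sup>2 / s"
      using assms by simp
    also have "\<dots> = s * (cmod x)\<^sup>2 + (1 / s) * (cmod y)\<^sup>2 - 2 * cmod x * cmod y"
      using assms by (simp add: power2_eq_square field_simps)
    finally show ?thesis by simp
  qed
  finally show ?thesis by (simp add: algebra_simps)
qed

lemma hardy_mean_add_le:
  assumes f: "f holomorphic_on ball 0 1" and g: "g holomorphic_on ball 0 1"
    and r: "0 < r" "r < 1" and s: "0 < s"
  shows "hardy_mean (\<lambda>z. f z + g z) r \<le> (1 + s) * hardy_mean f r + (1 + 1 / s) * hardy_mean g r"
proof -
  let ?I = "integral {0..2 * pi}"
  let ?F = "\<lambda>t. (cmod (f (complex_of_real r * cis t)))\<^sup>2"
  let ?G = "\<lambda>t. (cmod (g (complex_of_real r * cis t)))\<^sup>2"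
  have fg: "(\<lambda>z. f z + g z) holomorphic_on ball 0 1"
    using f g by (rule holomorphic_on_add)
  note iF = hardy_mean_integrable(2)[OF f r] and iG = hardy_mean_integrable(2)[OF g r]
  have "?I (\<lambda>t. (cmod (f (complex_of_real r * cis t) + g (complex_of_real r * cis t)))\<^sup>2)
      \<le> ?I (\<lambda>t. (1 + s) * ?F t + (1 + 1 / s) * ?G t)"
    by (rule integral_le[OF hardy_mean_integrable(2)[OF fg r]])
      (auto intro!: integrable_add integrable_on_mult_right iF iG cmod_add_power2_le s)
  also have "\<dots> = (1 + s) * ?I ?F + (1 + 1 / s) * ?I ?G"
    by (subst Henstock_Kurzweil_Integration.integral_add)
      (auto intro!: integrable_on_mult_right iF iG)
  finally have "(1 / (2 * pi)) * ?I (\<lambda>t. (cmod (f (complex_of_real r * cis t)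
        + g (complex_of_real r * cis t)))\<^sup>2)
      \<le> (1 / (2 * pi)) * ((1 + s) * ?I ?F + (1 + 1 / s) * ?I ?G)"
    by (rule mult_left_mono) simp
  then show ?thesis
    unfolding hardy_mean_def by (simp only: distrib_left mult.left_commute)
qed

lemma hardy_mean_cmult: "hardy_mean (\<lambda>z. c * f z) r = (cmod c)\<^sup>2 * hardy_mean f r"
  by (simp add: hardy_mean_def norm_mult power_mult_distrib)

lemma hardy_set_cmult:
  assumes "f \<in> hardy_set" shows "(\<lambda>z. c * f z) \<in> hardy_set"
proof -
  obtain M where M: "\<And>r. r \<in> {0<..<1} \<Longrightarrow> hardy_mean f r \<le> M"
    using assms unfolding hardy_set_def bdd_above_def by blast
  have "bdd_above (hardy_mean (\<lambda>z. c * f z) ` {0<..<1})"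
    by (rule bdd_aboveI2[where M = "(cmod c)\<^sup>2 * M"])
      (simp add: hardy_mean_cmult M mult_left_mono)
  then show ?thesis
    using assms by (auto simp: hardy_set_def intro!: holomorphic_intros)
qed

lemma hardy_set_add:
  assumes "f \<in> hardy_set" "g \<in> hardy_set" shows "(\<lambda>z. f z + g z) \<in> hardy_set"
proof -
  obtain M N where M: "\<And>r. r \<in> {0<..<1} \<Longrightarrow> hardy_mean f r \<le> M"
    using assms(1) unfolding hardy_set_def bdd_above_def by blast
  obtain N where N: "\<And>r. r \<in> {0<..<1} \<Longrightarrow> hardy_mean g r \<le> N"
    using assms(2) unfolding hardy_set_def bdd_above_def by blast
  have "hardy_mean (\<lambda>z. f z + g z) r \<le> 2 * M + 2 * N" if "r \<in> {0<..<1}" for r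
    using hardy_mean_add_le[of f g r 1] M[OF that] N[OF that] that assms
    by (auto simp: hardy_set_def)
  then have "bdd_above (hardy_mean (\<lambda>z. f z + g z) ` {0<..<1})"
    by (rule bdd_aboveI2)
  then show ?thesis
    using assms by (auto simp: hardy_set_def intro!: holomorphic_intros)
qed

lemma hardy_set_zero: "(\<lambda>z. 0) \<in> hardy_set"
  by (auto simp: hardy_set_def hardy_mean_def)

typedef hardy2 = hardy_set
  morphisms hardy_fun Abs_hardy2
  using hardy_set_zero by blast

setup_lifting type_definition_hardy2

instantiation hardy2 :: complex_normed_vector
begin

lift_definition zero_hardy2 :: hardy2 is "\<lambda>z. 0"
  by (rule hardy_set_zero)

lift_definition plus_hardy2 :: "hardy2 \<Rightarrow> hardy2 \<Rightarrow> hardy2" is "\<lambda>f g z. f z + g z"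
  by (rule hardy_set_add)

lift_definition uminus_hardy2 :: "hardy2 \<Rightarrow> hardy2" is "\<lambda>f z. - f z"
  using hardy_set_cmult[where c = "-1"] by simp

lift_definition minus_hardy2 :: "hardy2 \<Rightarrow> hardy2 \<Rightarrow> hardy2" is "\<lambda>f g z. f z - g z"
proof -
  fix f g :: "complex \<Rightarrow> complex"
  assume "f \<in> hardy_set" "g \<in> hardy_set"
  then show "(\<lambda>z. f z - g z) \<in> hardy_set"
    using hardy_set_add[OF _ hardy_set_cmult[where c = "-1"], of f g] by simp
qed

lift_definition scaleC_hardy2 :: "complex \<Rightarrow> hardy2 \<Rightarrow> hardy2" is "\<lambda>c f z. c * f z"
  by (rule hardy_set_cmult)

lift_definition scaleR_hardy2 :: "real \<Rightarrow> hardy2 \<Rightarrow> hardy2" is "\<lambda>r f z. complex_of_real r * f z"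
  by (rule hardy_set_cmult)

lift_definition norm_hardy2 :: "hardy2 \<Rightarrow> real" is
  "\<lambda>f. sqrt (SUP r\<in>{0<..<1}. hardy_mean f r)" .

definition "dist_hardy2 (f::hardy2) g = norm (f - g)"
definition "sgn_hardy2 (f::hardy2) = inverse (norm f) *\<^sub>R f"
definition [code del]:
  "(uniformity :: (hardy2 \<times> hardy2) filter) = (INF e\<in>{0<..}. principal {(x, y). dist x y < e})"
definition [code del]:
  "open (U :: hardy2 set) \<longleftrightarrow> (\<forall>x\<in>U. eventually (\<lambda>(x', y). x' = x \<longrightarrow> y \<in> U) uniformity)"

instance
proof -
  have bdd: "bdd_above (hardy_mean (hardy_fun f) ` {0<..<1})" for f
    using hardy_fun[of f] by (simp add: hardy_set_def)
  have hol: "hardy_fun f holomorphic_on ball 0 1" for f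
    using hardy_fun[of f] by (simp add: hardy_set_def)
  have mean_le: "hardy_mean (hardy_fun f) r \<le> (norm f)\<^sup>2" if "0 < r" "r < 1" for f r
  proof -
    have *: "hardy_mean (hardy_fun f) r \<le> (SUP r\<in>{0<..<1}. hardy_mean (hardy_fun f) r)"
      using that by (intro cSUP_upper bdd) auto
    with hardy_mean_nonneg[of "hardy_fun f" r] show ?thesis
      by (simp add: norm_hardy2.rep_eq)
  qed
  have norm_leI: "norm f \<le> C" if "0 \<le> C" "\<And>r. 0 < r \<Longrightarrow> r < 1 \<Longrightarrow> hardy_mean (hardy_fun f) r \<le> C\<^sup>2"
    for f C
    unfolding norm_hardy2.rep_eq
    by (rule real_le_lsqrt) (use that in \<open>auto intro!: cSUP_least\<close>)
  have norm_nonneg: "0 \<le> norm f" for f :: hardy2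
  proof -
    have "0 \<le> (SUP r\<in>{0<..<1}. hardy_mean (hardy_fun f) r)"
      by (rule cSUP_upper2[where x = "1/2"]) (auto intro: bdd hardy_mean_nonneg)
    then show ?thesis by (simp add: norm_hardy2.rep_eq)
  qed
  have eq0: "norm f = 0 \<longleftrightarrow> f = 0" for f :: hardy2
  proof
    assume "f = 0"
    have "norm f \<le> 0"
      by (rule norm_leI) (simp_all add: \<open>f = 0\<close> zero_hardy2.rep_eq hardy_mean_def)
    with norm_nonneg[of f] show "norm f = 0" by simp
  next
    assume n0: "norm f = 0"
    have circ: "hardy_fun f z = 0" if "z \<in> ball 0 1" "z \<noteq> 0" for z
    proof -
      define r where "r = cmod z"
      have r: "0 < r" "r < 1" using that by (auto simp: r_def)
      have "hardy_mean (hardy_fun f) r = 0"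
        using mean_le[OF r, of f] hardy_mean_nonneg[of "hardy_fun f" r] n0 by simp
      then have "integral {0..2 * pi} (\<lambda>t. (cmod (hardy_fun f (complex_of_real r * cis t)))\<^sup>2) = 0"
        by (simp add: hardy_mean_def)
      then have *: "\<forall>t\<in>{0..2 * pi}. (cmod (hardy_fun f (complex_of_real r * cis t)))\<^sup>2 = 0"
        by (subst (asm) integral_eq_0_iff[OF hardy_mean_integrable(1)[OF hol r]]) auto
      have "z = complex_of_real r * cis (Arg2pi z)"
        using Arg2pi_eq[of z] by (simp add: r_def cis_conv_exp)
      moreover have "Arg2pi z \<in> {0..2 * pi}"
        using Arg2pi_ge_0[of z] Arg2pi_lt_2pi[of z] by simp
      ultimately show ?thesis using * by (metis norm_eq_zero power_eq_0_iff)
    qed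
    have "hardy_fun f z = 0" for z
    proof -
      consider "z \<notin> ball 0 1" | "z \<in> ball 0 1" "z \<noteq> 0" | "z = 0" by blast
      then show ?thesis
      proof cases
        case 1
        then show ?thesis using hardy_fun[of f] by (simp add: hardy_set_def)
      next
        case 3
        have "isCont (hardy_fun f) 0"
          using holomorphic_on_imp_continuous_on[OF hol[of f]]
          by (simp add: continuous_on_eq_continuous_at)
        then have "(hardy_fun f \<longlongrightarrow> hardy_fun f 0) (at 0)"
          by (simp add: isCont_def)
        moreover have "(hardy_fun f \<longlongrightarrow> 0) (at 0)"
        proof (rule tendsto_eventually)
          show "\<forall>\<^sub>F z in at 0. hardy_fun f z = 0"
            unfolding eventually_at by (intro exI[of _ 1]) (auto intro!: circ)
        qed
        ultimately show ?thesis
          using 3 LIM_unique by blast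
      qed (use circ in auto)
    qed
    then show "f = 0"
      by (transfer) auto
  qed
  have tri: "norm (f + g) \<le> norm f + norm g" for f g :: hardy2
  proof (cases "f = 0 \<or> g = 0")
    case True
    have "0 + g = g" "f + 0 = f" by (transfer; simp)+
    with True norm_nonneg[of f] norm_nonneg[of g] show ?thesis by auto
  next
    case False
    with eq0[of f] eq0[of g] norm_nonneg[of f] norm_nonneg[of g]
    have pos: "0 < norm f" "0 < norm g" by auto
    show ?thesis
    proof (rule norm_leI)
      fix r :: real assume r: "0 < r" "r < 1"
      let ?s = "norm g / norm f"
      have s: "0 < ?s" using pos by simp
      have "hardy_mean (hardy_fun (f + g)) r
          \<le> (1 + ?s) * hardy_mean (hardy_fun f) r + (1 + 1 / ?s) * hardy_mean (hardy_fun g) r"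
        using hardy_mean_add_le[OF hol[of f] hol[of g] r s] by (simp add: plus_hardy2.rep_eq)
      also have "\<dots> \<le> (1 + ?s) * (norm f)\<^sup>2 + (1 + 1 / ?s) * (norm g)\<^sup>2"
        using pos by (intro add_mono mult_left_mono mean_le r) (simp_all add: add_nonneg_nonneg)
      also have "\<dots> = (norm f + norm g)\<^sup>2"
        using pos by (simp add: field_simps power2_eq_square)
      finally show "hardy_mean (hardy_fun (f + g)) r \<le> (norm f + norm g)\<^sup>2" .
    qed (use pos in simp)
  qed
  have scC_le: "norm (scaleC c f) \<le> cmod c * norm f" for c and f :: hardy2
    by (rule norm_leI)
      (auto simp: scaleC_hardy2.rep_eq hardy_mean_cmult power_mult_distrib norm_nonneg
        intro!: mult_left_mono mean_le)
  have scC: "norm (scaleC c f) = cmod c * norm f" for c and f :: hardy2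
  proof (cases "c = 0")
    case True
    have "scaleC 0 f = 0" by transfer simp
    with True eq0[of 0] show ?thesis by simp
  next
    case False
    have "scaleC (1 / c) (scaleC c f) = f"
      using False by transfer (simp add: fun_eq_iff)
    with scC_le[of "1 / c" "scaleC c f"] have "norm f \<le> norm (scaleC c f) / cmod c"
      by (simp add: norm_divide)
    then have "cmod c * norm f \<le> norm (scaleC c f)"
      using False by (simp add: field_simps)
    with scC_le[of c f] show ?thesis by simp
  qed
  have scR: "scaleC (complex_of_real r) f = scaleR r f" for r and f :: hardy2
    by transfer simp
  show "OFCLASS(hardy2, complex_normed_vector_class)"
  proof
    fix f g h :: hardy2 and a b :: real and c d :: complex
    show "f + g + h = f + (g + h)" "f + g = g + f" "0 + f = f" "- f + f = 0" "f - g = f + - g"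
      "a *\<^sub>R (f + g) = a *\<^sub>R f + a *\<^sub>R g" "(a + b) *\<^sub>R f = a *\<^sub>R f + b *\<^sub>R f"
      "a *\<^sub>R b *\<^sub>R f = (a * b) *\<^sub>R f" "1 *\<^sub>R f = f"
      "scaleC c (f + g) = scaleC c f + scaleC c g" "scaleC (c + d) f = scaleC c f + scaleC d f"
      "scaleC c (scaleC d f) = scaleC (c * d) f"
      by (transfer; simp add: algebra_simps)+
    show "norm (a *\<^sub>R f) = \<bar>a\<bar> * norm f"
      using scC[of "complex_of_real a" f] by (simp add: scR)
  qed (rule dist_hardy2_def sgn_hardy2_def uniformity_hardy2_def open_hardy2_def
      eq0 tri scC scR)+
qed

end

definition disk_self_map :: "(complex \<Rightarrow> complex) \<Rightarrow> bool" where
  "disk_self_map \<phi> \<longleftrightarrow> \<phi> holomorphic_on ball 0 1 \<and> \<phi> ` ball 0 1 \<subseteq> ball 0 1"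

text \<open>If \<open>\<psi>\<close> is bounded and analytic on the disk and \<open>\<phi>\<close> is an analytic self-map of it, then by
  Littlewood's subordination theorem the function below lies in the Hardy space for every \<open>f\<close>,
  so that \<open>Abs_hardy2\<close> is applied within its domain.\<close>

definition weighted_comp ::
    "(complex \<Rightarrow> complex) \<Rightarrow> (complex \<Rightarrow> complex) \<Rightarrow> hardy2 \<Rightarrow> hardy2" where
  "weighted_comp \<psi> \<phi> f =
    Abs_hardy2 (\<lambda>z. if z \<in> ball 0 1 then \<psi> z * hardy_fun f (\<phi> z) else 0)"

text \<open>The condition determines \<open>w\<close>, and it fails for every \<open>w\<close> if \<open>\<phi>\<close> is the identity or an
  elliptic automorphism, so these two cases need no separate exclusion.\<close>

definition denjoy_wolff_point :: "(complex \<Rightarrow> complex) \<Rightarrow> complex \<Rightarrow> bool" where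
  "denjoy_wolff_point \<phi> w \<longleftrightarrow> disk_self_map \<phi> \<and> w \<in> cball 0 1 \<and>
     (\<forall>K. compact K \<and> K \<subseteq> ball 0 1 \<longrightarrow> uniform_limit K (\<lambda>n. \<phi> ^^ n) (\<lambda>_. w) sequentially)"

end

theory Submission
  imports Defs "HOL-Complex_Analysis.Complex_Singularities"
begin

text \<open>Let \<open>T f = \<psi> \<cdot> f \<circ> \<phi>\<close> be power compact on the Hardy space. By Riesz theory every nonzero
  spectral value of \<open>T\<close> is an eigenvalue. If \<open>\<phi>\<close> fixes \<open>w\<close> in the open disk, then \<open>T\<close> acts
  triangularly with respect to the order of vanishing at \<open>w\<close>, with diagonal entries
  \<open>\<psi> w (\<phi>' w)\<^sup>m\<close>; this determines the eigenvalues and puts each diagonal entry into the spectrum.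
  The normalized reproducing kernels \<open>k\<^sub>a\<close> tend to zero pointwise as \<open>|a| \<rightarrow> 1\<close>, so a compact power
  of \<open>T\<close> sends them to zero in norm. Hence \<open>T\<close> is not invertible. Moreover \<open>\<phi>\<close> has no fixed
  point \<open>w\<close> on the circle if it is Lipschitz and \<open>\<psi>\<close> is bounded away from zero: evaluating
  \<open>T\<^sup>n k\<^sub>a\<close> at \<open>z\<close>, where \<open>a = \<phi>\<^sup>n z\<close> and \<open>z\<close> tends to \<open>w\<close> radially, bounds its norm from below.\<close>

section \<open>Power compact operators\<close>

lemma scaleC_zero_right [simp]: "scaleC a (0::'a::complex_normed_vector) = 0"
  by (metis mult_zero_right norm_eq_zero norm_scaleC)

lemma scaleC_zero_left [simp]: "scaleC 0 (x::'a::complex_normed_vector) = 0"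
  by (metis mult_zero_left norm_eq_zero norm_scaleC)

lemma scaleC_one [simp]: "scaleC 1 (x::'a::complex_normed_vector) = x"
  using scaleC_of_real[of 1 x] by simp

lemma scaleC_scaleR: "scaleC a (r *\<^sub>R x) = r *\<^sub>R scaleC a (x::'a::complex_normed_vector)"
  by (metis mult.commute scaleC_of_real scaleC_scaleC)

lemma bounded_clinear_scaleC: "bounded_clinear (scaleC a :: 'a::complex_normed_vector \<Rightarrow> 'a)"
  unfolding bounded_clinear_def
proof (intro conjI allI)
  show "bounded_linear (scaleC a :: 'a \<Rightarrow> 'a)"
    by (rule bounded_linear_intro[where K = "cmod a"])
      (simp_all add: scaleC_add_right scaleC_scaleR norm_scaleC)
qed (simp add: scaleC_scaleC mult.commute)

lemma scaleC_diff_right: "scaleC a (x - y) = scaleC a x - scaleC a (y::'a::complex_normed_vector)"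
  by (metis bounded_clinear_def bounded_clinear_scaleC bounded_linear.linear linear_diff)

lemma bounded_clinear_compose:
  "bounded_clinear f \<Longrightarrow> bounded_clinear g \<Longrightarrow> bounded_clinear (\<lambda>x. f (g x))"
  by (auto simp: bounded_clinear_def intro: bounded_linear_compose)

lemma bounded_clinear_add:
  "bounded_clinear f \<Longrightarrow> bounded_clinear g \<Longrightarrow> bounded_clinear (\<lambda>x. f x + g x)"
  by (auto simp: bounded_clinear_def scaleC_add_right intro: bounded_linear_add)

lemma bounded_clinear_diff:
  "bounded_clinear f \<Longrightarrow> bounded_clinear g \<Longrightarrow> bounded_clinear (\<lambda>x. f x - g x)"
  by (auto simp: bounded_clinear_def scaleC_diff_right intro: bounded_linear_sub)

lemma bounded_clinear_ident: "bounded_clinear (\<lambda>x. x)"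
  by (simp add: bounded_clinear_def bounded_linear_ident)

lemma bounded_clinear_funpow:
  fixes f :: "'a::complex_normed_vector \<Rightarrow> 'a"
  assumes "bounded_clinear f" shows "bounded_clinear (f ^^ n)"
  by (induction n) (simp_all add: bounded_clinear_ident id_def o_def bounded_clinear_compose assms)

text \<open>Compactness is defined through the image of the unit ball, so the sequence is scaled
  into it and linearity undoes the scaling in the limit. The maximum with 1 keeps the factor
  positive.\<close>

lemma compact_operator_subseq:
  assumes K: "compact_operator K" and bd: "\<And>j::nat. norm (x j) \<le> B"
  obtains l r where "strict_mono r" "(\<lambda>j. K (x (r j))) \<longlonglongrightarrow> l"
proof -
  define C where "C = max B 1"
  have C: "0 < C" "\<And>j. norm (x j) \<le> C" using bd by (auto simp: C_def le_max_iff_disj)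
  interpret K: bounded_linear K using K by (simp add: compact_operator_def bounded_clinear_def)
  have "seq_compact (closure (K ` cball 0 1))"
    using K by (simp add: compact_operator_def compact_imp_seq_compact)
  moreover have "K (x j /\<^sub>R C) \<in> closure (K ` cball 0 1)" for j
    using C by (intro subsetD[OF closure_subset] imageI) (simp add: field_simps)
  ultimately obtain l r where lr: "strict_mono r" "((\<lambda>j. K (x j /\<^sub>R C)) \<circ> r) \<longlonglongrightarrow> l"
    using seq_compactE[where f = "\<lambda>j. K (x j /\<^sub>R C)"] by metis
  from tendsto_scaleR[OF tendsto_const lr(2), of C] have "(\<lambda>j. K (x (r j))) \<longlonglongrightarrow> C *\<^sub>R l"
    using C by (simp add: o_def K.scaleR)
  with lr(1) that show thesis by blast
qed

text \<open>Riesz's lemma with constant 1/2: subtract from \<open>x\<close> an element of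
  \<open>U\<close> that is less than twice the distance away, and normalize.\<close>

lemma riesz_almost_orthogonal:
  fixes U :: "'a::real_normed_vector set"
  assumes U: "subspace U" "closed U" and x: "x \<notin> U" and V: "subspace V" "U \<subseteq> V" "x \<in> V"
  shows "\<exists>y\<in>V. norm y = 1 \<and> (\<forall>u\<in>U. 1 / 2 \<le> norm (y - u))"
proof -
  have ne: "U \<noteq> {}" using subspace_0[OF U(1)] by auto
  define d where "d = infdist x U"
  have d: "0 < d"
    using x ne in_closed_iff_infdist_zero[OF U(2) ne, of x] infdist_nonneg[of x U]
    by (auto simp: d_def less_le)
  then have "infdist x U < 2 * d" by (simp add: d_def)
  then obtain u where u: "u \<in> U" "dist x u < 2 * d"
    using cINF_less_iff[OF ne bdd_below_image_dist, of x "2 * d"] infdist_notempty[OF ne, of x]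
    by auto
  define n where "n = norm (x - u)"
  have n: "0 < n" "n < 2 * d" using u x by (auto simp: n_def dist_norm)
  define y where "y = (x - u) /\<^sub>R n"
  show ?thesis
  proof (intro bexI[of _ y] conjI ballI)
    show "y \<in> V" using u V by (auto simp: y_def intro!: subspace_scale subspace_diff)
    show "norm y = 1" using n by (simp add: y_def flip: n_def)
    fix v assume v: "v \<in> U"
    have "d \<le> dist x (u + n *\<^sub>R v)"
      unfolding d_def using u v U by (intro infdist_le subspace_add subspace_scale)
    also have "x - (u + n *\<^sub>R v) = n *\<^sub>R (y - v)"
      using n by (simp add: y_def algebra_simps)
    then have "dist x (u + n *\<^sub>R v) = n * norm (y - v)" using n by (simp add: dist_norm)
    finally have "n / 2 \<le> n * norm (y - v)" using n by linarith
    then show "1 / 2 \<le> norm (y - v)" using n by (simp add: field_simps)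
  qed
qed

text \<open>\<open>Q\<close> is the polynomial in \<open>T\<close> that divides
  \<open>T^n - \<mu>^n\<close> by \<open>T - \<mu>\<close>, and so it commutes with
  \<open>T - \<mu>\<close>. Through it, compactness of a power gives information on
  \<open>T - \<mu>\<close> itself.\<close>

lemma funpow_minus_scaleC_power_factor:
  fixes T :: "'a::complex_normed_vector \<Rightarrow> 'a"
  assumes T: "bounded_clinear T"
  shows "\<exists>Q. bounded_clinear Q \<and>
    (\<forall>x. Q (T x - scaleC \<mu> x) = (T ^^ n) x - scaleC (\<mu> ^ n) x) \<and>
    (\<forall>x. T (Q x) - scaleC \<mu> (Q x) = Q (T x - scaleC \<mu> x))"
proof (induction n)
  case 0
  show ?case
    by (rule exI[of _ "\<lambda>x. scaleC 0 x"])
      (use T in \<open>simp add: bounded_clinear_scaleC[of 0, simplified] linear_0 bounded_clinear_def bounded_linear.linear\<close>)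
next
  case (Suc n)
  then obtain Q where Q: "bounded_clinear Q"
    "\<And>x. Q (T x - scaleC \<mu> x) = (T ^^ n) x - scaleC (\<mu> ^ n) x"
    "\<And>x. T (Q x) - scaleC \<mu> (Q x) = Q (T x - scaleC \<mu> x)" by blast
  interpret T: bounded_linear T using T by (simp add: bounded_clinear_def)
  interpret Q: bounded_linear Q using Q by (simp add: bounded_clinear_def)
  have Ts: "T (scaleC a x) = scaleC a (T x)" "Q (scaleC a x) = scaleC a (Q x)" for a x
    using T Q by (simp_all add: bounded_clinear_def)
  \<comment> \<open>This comes from \<open>T^(n+1) - \<mu>^(n+1) = T (T^n - \<mu>^n) + \<mu>^n (T -
    \<mu>)\<close>.\<close>
  let ?Q = "\<lambda>x. T (Q x) + scaleC (\<mu> ^ n) x"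
  have "?Q (T x - scaleC \<mu> x) = (T ^^ Suc n) x - scaleC (\<mu> ^ Suc n) x" for x
    by (simp add: Q(2) T.diff Ts scaleC_diff_right scaleC_scaleC mult.commute)
  moreover have "T (?Q x) - scaleC \<mu> (?Q x) = ?Q (T x - scaleC \<mu> x)" for x
  proof -
    have "?Q (T x - scaleC \<mu> x) = T (T (Q x) - scaleC \<mu> (Q x)) + scaleC (\<mu> ^ n) (T x - scaleC \<mu> x)"
      by (simp add: Q(3))
    then show ?thesis
      by (simp add: T.diff T.add Ts scaleC_diff_right scaleC_add_right scaleC_scaleC mult.commute)
  qed
  moreover have "bounded_clinear ?Q"
    by (intro bounded_clinear_add bounded_clinear_compose[OF T] Q bounded_clinear_scaleC)
  ultimately show ?case by blast
qed

text \<open>The powers of \<open>S = T - \<mu>\<close> have closed ranges; if they decreased strictly, almost orthogonal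
  unit vectors would contradict compactness of \<open>T\<^sup>n = \<mu>\<^sup>n + QS\<close>.\<close>

lemma power_compact_spectrum_eigenvalue:
  fixes T :: "'a::complex_normed_vector \<Rightarrow> 'a"
  assumes T: "bounded_clinear T" and pc: "power_compact_operator T"
    and \<mu>: "\<mu> \<in> operator_spectrum T" "\<mu> \<noteq> 0"
  shows "\<exists>x. x \<noteq> 0 \<and> T x = scaleC \<mu> x"
proof (rule ccontr)
  assume noeig: "\<not> ?thesis"
  obtain n where K: "compact_operator (T ^^ n)" using pc by (auto simp: power_compact_operator_def)
  define S where "S = (\<lambda>x. T x - scaleC \<mu> x)"
  define \<nu> where "\<nu> = \<mu> ^ n"
  have \<nu>: "\<nu> \<noteq> 0" using \<mu> by (simp add: \<nu>_def)
  obtain Q where Q: "bounded_clinear Q"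
    "\<And>x. Q (S x) = (T ^^ n) x - scaleC \<nu> x" "\<And>x. S (Q x) = Q (S x)"
    using funpow_minus_scaleC_power_factor[OF T, of \<mu> n] unfolding S_def \<nu>_def by blast
  have Sbc: "bounded_clinear S"
    unfolding S_def by (intro bounded_clinear_diff T bounded_clinear_scaleC)
  interpret S: bounded_linear S using Sbc by (simp add: bounded_clinear_def)
  interpret Q: bounded_linear Q using Q by (simp add: bounded_clinear_def)
  have S0: "x = 0" if "S x = 0" for x using noeig that by (auto simp: S_def)
  \<comment> \<open>Since \<open>\<nu> x = T^n x - Q (S x)\<close>, convergence of
    \<open>T^n x\<close> and of \<open>S x\<close> along a subsequence forces convergence of
    \<open>x\<close> itself.\<close>
  have subseq: "\<exists>r l. strict_mono r \<and> (\<lambda>j. x (r j)) \<longlonglongrightarrow> l \<and> S l = y"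
    if bd: "\<And>j. norm (x j) \<le> B" and lim: "(\<lambda>j. S (x j)) \<longlonglongrightarrow> y" for x B y
  proof -
    obtain l r where r: "strict_mono r" and l: "(\<lambda>j. (T ^^ n) (x (r j))) \<longlonglongrightarrow> l"
      by (rule compact_operator_subseq[OF K bd])
    have Sr: "(\<lambda>j. S (x (r j))) \<longlonglongrightarrow> y" using LIMSEQ_subseq_LIMSEQ[OF lim r] by (simp add: o_def)
    have "(\<lambda>j. (T ^^ n) (x (r j)) - Q (S (x (r j)))) \<longlonglongrightarrow> l - Q y"
      by (intro tendsto_diff l Q.tendsto Sr)
    then have *: "(\<lambda>j. scaleC \<nu> (x (r j))) \<longlonglongrightarrow> l - Q y" by (simp add: Q)
    have "bounded_linear (scaleC (1 / \<nu>) :: 'a \<Rightarrow> 'a)"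
      using bounded_clinear_scaleC[of "1 / \<nu>"] unfolding bounded_clinear_def by blast
    from bounded_linear.tendsto[OF this *]
    have x: "(\<lambda>j. x (r j)) \<longlonglongrightarrow> scaleC (1 / \<nu>) (l - Q y)"
      using \<nu> by (simp add: scaleC_scaleC)
    have "S (scaleC (1 / \<nu>) (l - Q y)) = y" by (rule LIMSEQ_unique[OF S.tendsto[OF x] Sr])
    with x r show ?thesis by (intro exI conjI)
  qed
  \<comment> \<open>Otherwise unit vectors whose images tend to zero would accumulate at a unit
    vector in the kernel of \<open>S\<close>.\<close>
  have "\<exists>\<delta>>0. \<forall>x. \<delta> * norm x \<le> norm (S x)"
  proof (rule ccontr)
    assume "\<not> ?thesis"
    then have ex: "\<And>d. 0 < d \<Longrightarrow> \<exists>x. norm (S x) < d * norm x" by (meson not_le)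
    have "\<exists>x. norm x = 1 \<and> norm (S x) < d" if d: "0 < d" for d
    proof -
      obtain x where x: "norm (S x) < d * norm x" using ex[OF d] by blast
      then have "x \<noteq> 0" by auto
      then show ?thesis using x
        by (intro exI[of _ "x /\<^sub>R norm x"]) (simp add: S.scaleR field_simps)
    qed
    then have "\<forall>j. \<exists>x. norm x = 1 \<and> norm (S x) < inverse (real (Suc j))" by simp
    then obtain x where x: "\<And>j. norm (x j) = 1" "\<And>j. norm (S (x j)) < inverse (real (Suc j))" by metis
    have "(\<lambda>j. S (x j)) \<longlonglongrightarrow> 0"
      by (rule Lim_null_comparison[OF _ LIMSEQ_inverse_real_of_nat])
        (intro always_eventually allI less_imp_le x)
    from subseq[of x 1, OF _ this] obtain r l where l: "(\<lambda>j. x (r j)) \<longlonglongrightarrow> l" "S l = 0"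
      using x(1) by (metis order_refl)
    have "norm l = 1" using tendsto_norm[OF l(1)] x by (simp add: LIMSEQ_const_iff)
    with S0[OF l(2)] show False by simp
  qed
  then obtain \<delta> where \<delta>: "0 < \<delta>" "\<And>x. \<delta> * norm x \<le> norm (S x)" by blast
  have pow: "bounded_linear (S ^^ j)" for j
    using bounded_clinear_funpow[OF Sbc] by (simp add: bounded_clinear_def)
  have sub: "subspace (range (S ^^ j))" for j
    by (intro linear_subspace_image bounded_linear.linear pow subspace_UNIV)
  have closed_image: "closed (S ` A)" if "closed A" for A
  proof (unfold closed_sequential_limits, intro allI impI, elim conjE)
    fix y l assume y: "\<forall>j. y j \<in> S ` A" and lim: "y \<longlonglongrightarrow> l"
    then have "\<forall>j. \<exists>x. x \<in> A \<and> y j = S x" by blast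
    then obtain x where x: "\<And>j. x j \<in> A" "\<And>j. y j = S (x j)" by metis
    obtain B where B: "\<And>j. norm (y j) \<le> B"
      using convergent_imp_bounded[OF lim] by (auto simp: bounded_iff)
    have "norm (x j) \<le> B / \<delta>" for j
      using \<delta>(2)[of "x j"] \<delta>(1) B[of j] x(2)[of j] by (simp add: field_simps)
    moreover have "(\<lambda>j. S (x j)) \<longlonglongrightarrow> l" using lim by (simp add: x(2)[symmetric])
    ultimately obtain r v where "(\<lambda>j. x (r j)) \<longlonglongrightarrow> v" "S v = l" using subseq[of x "B / \<delta>" l] by metis
    with \<open>closed A\<close> x(1) show "l \<in> S ` A" by (metis closed_sequentially image_eqI)
  qed
  have cl: "closed (range (S ^^ j))" for j
  proof (induction j)
    case (Suc j)
    have "range (S ^^ Suc j) = S ` range (S ^^ j)" by (simp add: image_image)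
    with closed_image[OF Suc] show ?case by simp
  qed simp
  have dec: "range (S ^^ Suc j) \<subseteq> range (S ^^ j)" for j
    by (auto simp: funpow_swap1)
  have anti: "range (S ^^ j) \<subseteq> range (S ^^ i)" if "i \<le> j" for i j
    using that by (induction rule: dec_induct) (use dec in blast)+
  \<comment> \<open>If \<open>S\<close> were onto, the lower bound would make its inverse bounded by
    \<open>1 / \<delta>\<close>, and \<open>\<mu>\<close> would not be a spectral value.\<close>
  have "\<not> surj S"
  proof
    assume surj: "surj S"
    have "bij S" using surj S0 by (auto simp: bij_def S.linear linear_injective_0[OF S.linear])
    define R where "R = inv S"
    have R: "S (R x) = x" "R (S x) = x" for x
      using \<open>bij S\<close> by (simp_all add: R_def bij_is_surj surj_f_inv_f bij_is_inj)
    have inj: "x = y" if "S x = S y" for x y using that R by metis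
    have "bounded_clinear R"
      unfolding bounded_clinear_def
    proof (intro conjI allI)
      show "R (scaleC c x) = scaleC c (R x)" for c x
        by (rule inj) (use Sbc R in \<open>simp add: bounded_clinear_def\<close>)
      show "bounded_linear R"
      proof (rule bounded_linear_intro[where K = "1 / \<delta>"])
        show "norm (R x) \<le> norm x * (1 / \<delta>)" for x
          using \<delta>(2)[of "R x"] \<delta>(1) by (simp add: R field_simps)
      qed (rule inj; simp add: R S.add S.scaleR)+
    qed
    then have "invertible_operator S"
      by (auto simp: invertible_operator_def fun_eq_iff R intro!: exI[of _ R])
    with \<mu> show False by (simp add: operator_spectrum_def S_def)
  qed
  then obtain v where v: "v \<notin> range S" by auto
  \<comment> \<open>Because \<open>S^j\<close> is injective, \<open>S^j v\<close> stays outside the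
    range of \<open>S^(j+1)\<close>. The ranges thus decrease strictly, and Riesz's lemma applies to
    each consecutive pair.\<close>
  have "\<exists>y\<in>range (S ^^ j). norm y = 1 \<and> (\<forall>u\<in>range (S ^^ Suc j). 1 / 2 \<le> norm (y - u))" for j
  proof -
    have "(S ^^ j) v \<notin> range (S ^^ Suc j)"
    proof
      assume "(S ^^ j) v \<in> range (S ^^ Suc j)"
      then obtain u where "(S ^^ j) v = (S ^^ j) (S u)" by (auto simp: funpow_swap1)
      moreover have "inj (S ^^ j)"
        using S0 by (intro inj_fn) (simp add: linear_injective_0[OF S.linear])
      ultimately have "v = S u" by (meson injD)
      with v show False by blast
    qed
    then show ?thesis by (rule riesz_almost_orthogonal[OF sub cl _ sub dec rangeI])
  qed
  then obtain y where y: "\<And>j. y j \<in> range (S ^^ j)" "\<And>j. norm (y j) = 1"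
    "\<And>j u. u \<in> range (S ^^ Suc j) \<Longrightarrow> 1 / 2 \<le> norm (y j - u)" by metis
  have comm: "S ((T ^^ n) x) = (T ^^ n) (S x)" for x
  proof -
    have "(T ^^ n) x = Q (S x) + scaleC \<nu> x" "(T ^^ n) (S x) = Q (S (S x)) + scaleC \<nu> (S x)" for x
      by (simp_all add: Q(2))
    then show ?thesis using Q(3) Sbc by (simp add: S.add bounded_clinear_def)
  qed
  have inv: "F x \<in> range (S ^^ j)" if "x \<in> range (S ^^ j)" and F: "\<And>x. S (F x) = F (S x)" for F x j
  proof -
    have "F ((S ^^ j) z) = (S ^^ j) (F z)" for z
      by (induction j) (simp_all add: F[symmetric])
    then show ?thesis using that(1) by auto
  qed
  \<comment> \<open>The difference is \<open>\<nu> (y i - u)\<close> with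
    \<open>u = (T^n (y j) - Q (S (y i))) / \<nu>\<close>. As \<open>i < j\<close>, this
    \<open>u\<close> lies in the range of \<open>S^(i+1)\<close>, from which \<open>y i\<close> has
    distance at least 1/2.\<close>
  have sep: "cmod \<nu> / 2 \<le> norm ((T ^^ n) (y i) - (T ^^ n) (y j))" if "i < j" for i j
  proof -
    have "Q (S (y i)) \<in> range (S ^^ Suc i)"
    proof -
      have "Q (y i) \<in> range (S ^^ i)" by (rule inv[where F = Q, OF y(1) Q(3)])
      then show ?thesis by (auto simp: Q(3)[symmetric] image_iff)
    qed
    moreover have "(T ^^ n) (y j) \<in> range (S ^^ Suc i)"
      using inv[where F = "T ^^ n", OF y(1) comm, of j] anti[of "Suc i" j] that by (meson Suc_leI subsetD)
    ultimately have "scaleC (1 / \<nu>) ((T ^^ n) (y j) - Q (S (y i))) \<in> range (S ^^ Suc i)"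
      by (intro inv[where F = "scaleC (1 / \<nu>)"] subspace_diff sub)
        (use Sbc in \<open>simp_all add: bounded_clinear_def del: funpow.simps\<close>)
    from y(3)[OF this] have "cmod \<nu> * (1 / 2)
        \<le> norm (scaleC \<nu> (y i - scaleC (1 / \<nu>) ((T ^^ n) (y j) - Q (S (y i)))))"
      unfolding norm_scaleC by (intro mult_left_mono) auto
    also have "scaleC \<nu> (y i - scaleC (1 / \<nu>) ((T ^^ n) (y j) - Q (S (y i))))
        = (T ^^ n) (y i) - (T ^^ n) (y j)"
      using \<nu> Q(2)[of "y i"] by (simp add: scaleC_diff_right scaleC_scaleC)
    finally show ?thesis by simp
  qed
  obtain l r where r: "strict_mono r" "(\<lambda>j. (T ^^ n) (y (r j))) \<longlonglongrightarrow> l"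
    using compact_operator_subseq[OF K, of y 1] y(2) by (metis order_refl)
  from LIMSEQ_imp_Cauchy[OF r(2)] have "Cauchy (\<lambda>j. (T ^^ n) (y (r j)))" .
  then obtain M where M: "\<And>i j. i \<ge> M \<Longrightarrow> j \<ge> M \<Longrightarrow>
      norm ((T ^^ n) (y (r i)) - (T ^^ n) (y (r j))) < cmod \<nu> / 2"
    unfolding Cauchy_iff using \<nu> by (metis half_gt_zero zero_less_norm_iff)
  from M[of M "Suc M"] sep[of "r M" "r (Suc M)"] r(1) show False by (simp add: strict_mono_Suc_iff)
qed

section \<open>Poisson kernel and subordination\<close>

text \<open>The contour is parametrized by angle, with \<open>d\<zeta> = i \<zeta> dt\<close>; the
  factor \<open>- \<i>\<close> clears the imaginary unit. The case \<open>z = 0\<close> is the mean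
  value property.\<close>

lemma circle_cauchy_formula:
  assumes r: "0 < r" and h: "continuous_on (cball 0 r) h" "h holomorphic_on ball 0 r" and z: "cmod z < r"
  shows "((\<lambda>t. h (of_real r * cis t) * (of_real r * cis t / (of_real r * cis t - z)))
    has_integral of_real (2 * pi) * h z) {0..2 * pi}"
proof -
  have "((\<lambda>u. h u / (u - z)) has_contour_integral (2 * of_real pi * \<i> * h z))
      (part_circlepath 0 r 0 (2 * pi))"
    using Cauchy_integral_circlepath[OF h, of z] z by (simp add: circlepath_def)
  then have "((\<lambda>t. h (0 + r * cis t) / (0 + r * cis t - z) * r * \<i> * cis t)
      has_integral 2 * of_real pi * \<i> * h z) {0..2 * pi}"
    by (subst (asm) has_contour_integral_part_circlepath_iff) auto
  from has_integral_mult_right[OF this, of "- \<i>"] show ?thesis by (simp add: algebra_simps)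
qed

text \<open>The factor \<open>1 / (2 * pi)\<close> is left out, so the total mass is
  \<open>2 * pi\<close>.\<close>

definition poisson_kernel :: "real \<Rightarrow> complex \<Rightarrow> real \<Rightarrow> real" where
  "poisson_kernel R z t = (R\<^sup>2 - (cmod z)\<^sup>2) / (cmod (of_real R * cis t - z))\<^sup>2"

lemma circle_neq: "cmod z < R \<Longrightarrow> of_real R * cis t \<noteq> z"
  using norm_mult[of "of_real R" "cis t"] by auto

lemma poisson_kernel_nonneg: "cmod z < R \<Longrightarrow> 0 \<le> poisson_kernel R z t"
  by (simp add: poisson_kernel_def power_mono)

text \<open>For fixed \<open>t\<close> this exhibits the kernel as the real part of a function
  holomorphic in \<open>z\<close>, hence as harmonic in \<open>z\<close>; subordination rests on
  that.\<close>

lemma poisson_kernel_eq_Re: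
  assumes "cmod z < R"
  shows "poisson_kernel R z t = Re ((of_real R * cis t + z) / (of_real R * cis t - z))"
proof -
  define \<zeta> where "\<zeta> = of_real R * cis t"
  have "0 < R" using assms norm_ge_zero[of z] by linarith
  then have R: "R\<^sup>2 = (Re \<zeta>)\<^sup>2 + (Im \<zeta>)\<^sup>2"
    by (simp add: \<zeta>_def power_mult_distrib flip: distrib_left)
  show ?thesis
    unfolding poisson_kernel_def \<zeta>_def[symmetric] Re_divide cmod_power2 R
    by (simp add: power2_eq_square algebra_simps)
qed

text \<open>Harnack's upper bound: the denominator is at least \<open>(R - cmod z)\<^sup>2\<close>,
  and one factor cancels.\<close>

lemma poisson_kernel_le:
  assumes "cmod z < R"
  shows "poisson_kernel R z t \<le> (R + cmod z) / (R - cmod z)"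
proof -
  have R: "0 < R" using assms norm_ge_zero[of z] by linarith
  have "R - cmod z \<le> cmod (of_real R * cis t - z)"
    using norm_triangle_ineq2[of "of_real R * cis t" z] R by (simp add: norm_mult)
  then have "(R - cmod z)\<^sup>2 \<le> (cmod (of_real R * cis t - z))\<^sup>2"
    using assms by (intro power_mono) auto
  then have "poisson_kernel R z t \<le> (R\<^sup>2 - (cmod z)\<^sup>2) / (R - cmod z)\<^sup>2"
    unfolding poisson_kernel_def using assms by (intro divide_left_mono) (auto intro!: power_mono mult_pos_pos simp: circle_neq)
  also have "\<dots> = (R + cmod z) / (R - cmod z)"
  proof -
    have "R\<^sup>2 - (cmod z)\<^sup>2 = (R + cmod z) * (R - cmod z)"
      by (simp add: power2_eq_square algebra_simps)
    then show ?thesis using assms by (simp add: power2_eq_square)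
  qed
  finally show ?thesis .
qed

lemma continuous_on_poisson_kernel [continuous_intros]:
  assumes "continuous_on S g" "continuous_on S h" "\<And>x. x \<in> S \<Longrightarrow> cmod (g x) < R"
  shows "continuous_on S (\<lambda>x. poisson_kernel R (g x) (h x))"
  unfolding poisson_kernel_def using assms circle_neq
  by (auto intro!: continuous_intros)

text \<open>Cauchy's formula for \<open>\<zeta> \<mapsto> f \<zeta> (R\<^sup>2 - |z|\<^sup>2) / (R\<^sup>2 - cnj z \<zeta>)\<close>.\<close>

lemma poisson_formula:
  assumes R: "0 < R" and f: "continuous_on (cball 0 R) f" "f holomorphic_on ball 0 R" and z: "cmod z < R"
  shows "((\<lambda>t. of_real (poisson_kernel R z t) * f (of_real R * cis t))
    has_integral of_real (2 * pi) * f z) {0..2 * pi}"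
proof -
  let ?N = "of_real (R\<^sup>2 - (cmod z)\<^sup>2) :: complex"
  let ?h = "\<lambda>u. f u * (?N / (of_real (R\<^sup>2) - cnj z * u))"
  have N: "?N = of_real (R\<^sup>2) - cnj z * z"
    by (simp add: complex_norm_square mult.commute del: of_real_power)
  have nz: "complex_of_real (R\<^sup>2) \<noteq> cnj z * u" if "cmod u \<le> R" for u
  proof
    assume "complex_of_real (R\<^sup>2) = cnj z * u"
    then have "R * R = cmod z * cmod u"
      by (metis complex_mod_cnj norm_mult norm_of_real abs_of_nonneg power2_eq_square zero_le_power2)
    also have "\<dots> \<le> cmod z * R" using that by (intro mult_left_mono) auto
    also have "\<dots> < R * R" using z R by simp
    finally show False by simp
  qed
  have "?h holomorphic_on ball 0 R" "continuous_on (cball 0 R) ?h"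
    using nz by (auto intro!: holomorphic_intros continuous_intros f simp del: of_real_power)
  from circle_cauchy_formula[OF R this(2,1) z]
  have *: "((\<lambda>t. ?h (of_real R * cis t) * (of_real R * cis t / (of_real R * cis t - z)))
      has_integral of_real (2 * pi) * ?h z) {0..2 * pi}" .
  have hz: "?h z = f z" using nz[of z] z by (simp add: N del: of_real_power of_real_diff)
  \<comment> \<open>On the circle \<open>R\<^sup>2 = \<zeta> * cnj \<zeta>\<close>, so the extra
    factor turns the Cauchy kernel into the Poisson kernel.\<close>
  have "?h (of_real R * cis t) * (of_real R * cis t / (of_real R * cis t - z)) =
      of_real (poisson_kernel R z t) * f (of_real R * cis t)" for t
  proof -
    define \<zeta> where "\<zeta> = of_real R * cis t"
    have "R\<^sup>2 = (cmod \<zeta>)\<^sup>2" by (simp add: \<zeta>_def norm_mult)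
    then have RR: "of_real (R\<^sup>2) = \<zeta> * cnj \<zeta>" by (simp only: complex_norm_square)
    have "\<zeta> \<noteq> z" "\<zeta> \<noteq> 0" using circle_neq[OF z, of t] R by (auto simp: \<zeta>_def)
    then have ne: "\<zeta> \<noteq> 0" "\<zeta> - z \<noteq> 0" "cnj \<zeta> - cnj z \<noteq> 0" by simp_all
    have 1: "of_real (R\<^sup>2) - cnj z * \<zeta> = \<zeta> * (cnj \<zeta> - cnj z)" by (simp only: RR algebra_simps)
    have 2: "of_real ((cmod (\<zeta> - z))\<^sup>2) = (\<zeta> - z) * (cnj \<zeta> - cnj z)"
      by (simp only: complex_norm_square complex_cnj_diff)
    have "a * (N / (x * w)) * (x / v) = N / (v * w) * a"
      if "x \<noteq> 0" "v \<noteq> 0" "w \<noteq> 0" for a N x v w :: complex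
      using that by (simp add: field_simps)
    from this[OF ne] show ?thesis
      unfolding poisson_kernel_def \<zeta>_def[symmetric] of_real_divide 1 2 .
  qed
  with * show ?thesis unfolding hz by (simp only:)
qed

lemma poisson_kernel_integral:
  assumes "0 < R" "cmod z < R"
  shows "((\<lambda>t. poisson_kernel R z t) has_integral 2 * pi) {0..2 * pi}"
  using has_integral_linear[OF poisson_formula[of R "\<lambda>_. 1" z] bounded_linear_Re] assms
  by (simp add: o_def)

text \<open>Integrate the nonnegative function \<open>P |f(\<zeta>) - f(z)|^2\<close> and expand the
  square; the Poisson formula evaluates the cross term, and the total mass of the kernel the
  constant one.\<close>

lemma norm_power2_le_poisson:
  assumes R: "0 < R" and f: "continuous_on (cball 0 R) f" "f holomorphic_on ball 0 R" and z: "cmod z < R"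
  shows "2 * pi * (cmod (f z))\<^sup>2
    \<le> integral {0..2 * pi} (\<lambda>t. poisson_kernel R z t * (cmod (f (of_real R * cis t)))\<^sup>2)"
proof -
  let ?P = "poisson_kernel R z" and ?f = "\<lambda>t. f (of_real R * cis t)"
  have "continuous_on {0..2 * pi} ?f"
    by (rule continuous_on_compose2[OF f(1)]) (use R in \<open>auto intro!: continuous_intros simp: norm_mult\<close>)
  then have "continuous_on {0..2 * pi} (\<lambda>t. ?P t * (cmod (?f t))\<^sup>2)"
    using z by (intro continuous_intros) auto
  then have I: "((\<lambda>t. ?P t * (cmod (?f t))\<^sup>2) has_integral
      integral {0..2 * pi} (\<lambda>t. ?P t * (cmod (?f t))\<^sup>2)) {0..2 * pi}"
    by (intro integrable_integral integrable_continuous_real)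
  have J: "((\<lambda>t. Re (cnj (f z) * (of_real (?P t) * ?f t))) has_integral
      Re (cnj (f z) * (of_real (2 * pi) * f z))) {0..2 * pi}"
    using has_integral_linear[OF has_integral_mult_right[OF poisson_formula[OF assms], of "cnj (f z)"] bounded_linear_Re]
    by (simp add: o_def)
  have K: "((\<lambda>t. ?P t * (cmod (f z))\<^sup>2) has_integral 2 * pi * (cmod (f z))\<^sup>2) {0..2 * pi}"
    by (rule has_integral_mult_left[OF poisson_kernel_integral[OF R z]])
  note total = has_integral_add[OF has_integral_diff[OF I has_integral_mult_right[OF J, of 2]] K]
  have "Re (cnj (f z) * (of_real (2 * pi) * f z)) = 2 * pi * (cmod (f z))\<^sup>2"
    unfolding cmod_power2 by (simp add: power2_eq_square algebra_simps)
  moreover have "0 \<le> ?P t * (cmod (?f t))\<^sup>2 - 2 * Re (cnj (f z) * (of_real (?P t) * ?f t))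
      + ?P t * (cmod (f z))\<^sup>2" for t
  proof -
    have "?P t * (cmod (?f t))\<^sup>2 - 2 * Re (cnj (f z) * (of_real (?P t) * ?f t))
      + ?P t * (cmod (f z))\<^sup>2 = ?P t * (cmod (?f t - f z))\<^sup>2"
      unfolding cmod_power2 by (simp add: power2_eq_square algebra_simps)
    then show ?thesis using poisson_kernel_nonneg[OF z, of t] by simp
  qed
  then have "0 \<le> integral {0..2 * pi} (\<lambda>t. ?P t * (cmod (?f t))\<^sup>2)
      - 2 * Re (cnj (f z) * (of_real (2 * pi) * f z)) + 2 * pi * (cmod (f z))\<^sup>2"
    by (intro has_integral_nonneg[OF total])
  ultimately show ?thesis by simp
qed

lemma hardy_mean_point_evaluation:
  assumes f: "f holomorphic_on ball 0 1" and z: "cmod z < R" and R: "R < 1"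
  shows "(cmod (f z))\<^sup>2 \<le> (R + cmod z) / (R - cmod z) * hardy_mean f R"
proof -
  have R0: "0 < R" using z norm_ge_zero[of z] by linarith
  have hol: "f holomorphic_on cball 0 R" using f R by (rule_tac holomorphic_on_subset) auto
  have f': "continuous_on (cball 0 R) f" "f holomorphic_on ball 0 R"
    using hol by (auto intro: holomorphic_on_imp_continuous_on holomorphic_on_subset)
  note cont = hardy_mean_integrable(1)[OF f R0 R]
  have "2 * pi * (cmod (f z))\<^sup>2
    \<le> integral {0..2 * pi} (\<lambda>t. poisson_kernel R z t * (cmod (f (of_real R * cis t)))\<^sup>2)"
    by (rule norm_power2_le_poisson[OF R0 f' z])
  also have "\<dots> \<le> integral {0..2 * pi} (\<lambda>t. (R + cmod z) / (R - cmod z) * (cmod (f (of_real R * cis t)))\<^sup>2)"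
    using z by (intro integral_le integrable_continuous_real continuous_intros cont
        mult_right_mono poisson_kernel_le) auto
  also have "\<dots> = 2 * pi * ((R + cmod z) / (R - cmod z) * hardy_mean f R)"
    by (simp add: hardy_mean_def)
  finally show ?thesis by (simp only: mult_le_cancel_left_pos pi_gt_zero mult_pos_pos zero_less_numeral)
qed

text \<open>Littlewood's subordination: \<open>|f|\<^sup>2\<close> lies below its Poisson integral over the larger circle,
  whose composition with \<open>\<phi>\<close> is harmonic, so that its mean is the value at \<open>\<phi> 0\<close>.\<close>

lemma hardy_mean_compose_le:
  assumes f: "f holomorphic_on ball 0 1" and \<phi>: "\<phi> holomorphic_on ball 0 1"
    and r: "0 < r" "r < 1" and R: "R < 1" and sub: "\<And>z. cmod z \<le> r \<Longrightarrow> cmod (\<phi> z) < R"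
  shows "hardy_mean (\<lambda>z. f (\<phi> z)) r \<le> (R + cmod (\<phi> 0)) / (R - cmod (\<phi> 0)) * hardy_mean f R"
proof -
  have 0: "cmod (\<phi> 0) < R" using sub r by simp
  have R0: "0 < R" using 0 norm_ge_zero[of "\<phi> 0"] by linarith
  have hol: "f holomorphic_on cball 0 R" using f R by (rule_tac holomorphic_on_subset) auto
  have f': "continuous_on (cball 0 R) f" "f holomorphic_on ball 0 R"
    using hol by (auto intro: holomorphic_on_imp_continuous_on holomorphic_on_subset)
  have \<phi>r: "\<phi> holomorphic_on cball 0 r" using \<phi> r by (rule_tac holomorphic_on_subset) auto
  let ?F = "\<lambda>t. (cmod (f (of_real R * cis t)))\<^sup>2" and ?\<phi> = "\<lambda>s. \<phi> (of_real r * cis s)"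
  let ?I = "integral {0..2 * pi}"
  have \<phi>R: "cmod (?\<phi> s) < R" for s using r by (intro sub) (simp add: norm_mult)
  have cF: "continuous_on {0..2 * pi} ?F" by (rule hardy_mean_integrable(1)[OF f R0 R])
  have c\<phi>: "continuous_on {0..2 * pi} ?\<phi>"
    by (rule continuous_on_compose2[OF holomorphic_on_imp_continuous_on[OF \<phi>r]])
      (use r in \<open>auto intro!: continuous_intros simp: norm_mult\<close>)
  have "continuous_on (cbox (0, 0) (2 * pi, 2 * pi)) (\<lambda>x. poisson_kernel R (?\<phi> (fst x)) (snd x) * ?F (snd x))"
    using \<phi>R by (intro continuous_intros continuous_on_compose2[OF cF] continuous_on_compose2[OF c\<phi>])
      (auto simp: cbox_Pair_eq)
  then have cont: "continuous_on (cbox (0, 0) (2 * pi, 2 * pi)) (\<lambda>(s, t). poisson_kernel R (?\<phi> s) t * ?F t)"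
    by (simp add: case_prod_unfold)
  have "continuous_on {0..2 * pi} (\<lambda>s. ?I (\<lambda>t. poisson_kernel R (?\<phi> s) t * ?F t))"
    using integral_continuous_on_param[of "{0..2 * pi}" 0 "2 * pi" "\<lambda>s t. poisson_kernel R (?\<phi> s) t * ?F t"] cont
    by (simp add: cbox_Pair_eq)
  moreover have "continuous_on {0..2 * pi} (\<lambda>s. f (?\<phi> s))"
    by (rule continuous_on_compose2[OF f'(1) c\<phi>]) (auto simp: less_imp_le[OF \<phi>R])
  then have "continuous_on {0..2 * pi} (\<lambda>s. 2 * pi * (cmod (f (?\<phi> s)))\<^sup>2)"
    by (intro continuous_intros)
  ultimately have "?I (\<lambda>s. 2 * pi * (cmod (f (?\<phi> s)))\<^sup>2)
      \<le> ?I (\<lambda>s. ?I (\<lambda>t. poisson_kernel R (?\<phi> s) t * ?F t))"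
    by (intro integral_le integrable_continuous_real norm_power2_le_poisson[OF R0 f'] \<phi>R)
  also have "\<dots> = ?I (\<lambda>t. ?I (\<lambda>s. poisson_kernel R (?\<phi> s) t * ?F t))"
    using integral_swap_continuous[OF cont] by simp
  also have "\<dots> = ?I (\<lambda>t. (2 * pi * poisson_kernel R (\<phi> 0) t) * ?F t)"
  \<comment> \<open>After the order of integration is exchanged, the inner integral is over the
    angle on the circle of radius \<open>r\<close>. It is evaluated by the mean value property of
    the kernel composed with \<open>\<phi>\<close>.\<close>
  proof (rule integral_cong)
    fix t
    let ?h = "\<lambda>z. (of_real R * cis t + \<phi> z) / (of_real R * cis t - \<phi> z)"
    have "?h holomorphic_on cball 0 r"
      using circle_neq[OF sub, of _ t] by (intro holomorphic_intros \<phi>r) auto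
    then have "continuous_on (cball 0 r) ?h" "?h holomorphic_on ball 0 r"
      by (auto intro: holomorphic_on_imp_continuous_on holomorphic_on_subset)
    from has_integral_linear[OF circle_cauchy_formula[OF r(1) this, of 0] bounded_linear_Re] r
    have "((\<lambda>s. Re (?h (of_real r * cis s))) has_integral 2 * pi * Re (?h 0)) {0..2 * pi}"
      by (simp add: o_def del: times_divide_eq_right)
    then have "((\<lambda>s. poisson_kernel R (?\<phi> s) t) has_integral 2 * pi * poisson_kernel R (\<phi> 0) t) {0..2 * pi}"
      by (simp add: poisson_kernel_eq_Re \<phi>R 0)
    from has_integral_mult_left[OF this, of "?F t"]
    show "?I (\<lambda>s. poisson_kernel R (?\<phi> s) t * ?F t) = (2 * pi * poisson_kernel R (\<phi> 0) t) * ?F t"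
      by (rule integral_unique)
  qed
  also have "\<dots> \<le> ?I (\<lambda>t. (2 * pi * ((R + cmod (\<phi> 0)) / (R - cmod (\<phi> 0)))) * ?F t)"
  proof (rule integral_le)
    have "continuous_on {0..2 * pi} (poisson_kernel R (\<phi> 0))"
      using 0 continuous_on_poisson_kernel[of "{0..2 * pi}" "\<lambda>_. \<phi> 0" "\<lambda>t. t" R] by simp
    then show "(\<lambda>t. (2 * pi * poisson_kernel R (\<phi> 0) t) * ?F t) integrable_on {0..2 * pi}"
      by (intro integrable_continuous_real continuous_on_mult continuous_on_const cF)
    show "(\<lambda>t. (2 * pi * ((R + cmod (\<phi> 0)) / (R - cmod (\<phi> 0)))) * ?F t) integrable_on {0..2 * pi}"
      by (intro integrable_continuous_real continuous_on_mult continuous_on_const cF)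
    show "(2 * pi * poisson_kernel R (\<phi> 0) t) * ?F t
        \<le> (2 * pi * ((R + cmod (\<phi> 0)) / (R - cmod (\<phi> 0)))) * ?F t" for t
      by (intro mult_right_mono mult_left_mono poisson_kernel_le[OF 0]) auto
  qed
  finally have "2 * pi * ?I (\<lambda>s. (cmod (f (?\<phi> s)))\<^sup>2)
      \<le> (2 * pi * ((R + cmod (\<phi> 0)) / (R - cmod (\<phi> 0)))) * ?I ?F" by simp
  then have "2 * pi * ?I (\<lambda>s. (cmod (f (?\<phi> s)))\<^sup>2)
      \<le> 2 * pi * ((R + cmod (\<phi> 0)) / (R - cmod (\<phi> 0)) * ?I ?F)" by (simp only: mult.assoc)
  then have "?I (\<lambda>s. (cmod (f (?\<phi> s)))\<^sup>2) \<le> (R + cmod (\<phi> 0)) / (R - cmod (\<phi> 0)) * ?I ?F"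
    by (simp only: mult_le_cancel_left_pos pi_gt_zero mult_pos_pos zero_less_numeral)
  from mult_left_mono[OF this, of "1 / (2 * pi)"] show ?thesis
    unfolding hardy_mean_def by (simp only: mult.left_commute) simp
qed

section \<open>Weighted composition operators on the Hardy space\<close>

lemma hardy_fun_holomorphic: "hardy_fun f holomorphic_on ball 0 1"
  using hardy_fun[of f] by (simp add: hardy_set_def)

lemma hardy_mean_le_norm: "0 < r \<Longrightarrow> r < 1 \<Longrightarrow> hardy_mean (hardy_fun f) r \<le> (norm f)\<^sup>2"
proof -
  assume r: "0 < r" "r < 1"
  have "hardy_mean (hardy_fun f) r \<le> (SUP r\<in>{0<..<1}. hardy_mean (hardy_fun f) r)"
    using r hardy_fun[of f] by (intro cSUP_upper) (auto simp: hardy_set_def)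
  with hardy_mean_nonneg[of "hardy_fun f" r] show ?thesis by (simp add: norm_hardy2.rep_eq)
qed

lemma norm_hardy_leI:
  "0 \<le> C \<Longrightarrow> (\<And>r. 0 < r \<Longrightarrow> r < 1 \<Longrightarrow> hardy_mean (hardy_fun f) r \<le> C\<^sup>2) \<Longrightarrow> norm f \<le> C"
  unfolding norm_hardy2.rep_eq by (rule real_le_lsqrt) (auto intro!: cSUP_least)

lemma hardy_eqI:
  assumes "\<And>z. cmod z < 1 \<Longrightarrow> hardy_fun f z = hardy_fun g z"
  shows "f = g"
proof -
  have "hardy_fun f z = hardy_fun g z" for z
    using assms hardy_fun[of f] hardy_fun[of g] by (cases "z \<in> ball 0 1") (auto simp: hardy_set_def)
  then show ?thesis by (simp add: hardy_fun_inject[symmetric] fun_eq_iff)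
qed

lemma hardy_fun_linear [simp]:
  "hardy_fun 0 z = 0" "hardy_fun (f + g) z = hardy_fun f z + hardy_fun g z"
  "hardy_fun (f - g) z = hardy_fun f z - hardy_fun g z"
  "hardy_fun (scaleC a f) z = a * hardy_fun f z"
  "hardy_fun (r *\<^sub>R f) z = of_real r * hardy_fun f z"
  by (simp_all add: zero_hardy2.rep_eq plus_hardy2.rep_eq minus_hardy2.rep_eq scaleC_hardy2.rep_eq
      scaleR_hardy2.rep_eq)

lemma hardy_point_evaluation:
  assumes z: "cmod z < 1"
  shows "(cmod (hardy_fun f z))\<^sup>2 \<le> 4 / (1 - cmod z) * (norm f)\<^sup>2"
proof -
  \<comment> \<open>Halfway to the unit circle: then \<open>R - cmod z = (1 - cmod z) / 2\<close>,
    and bounding the numerator by 2 yields the constant 4.\<close>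
  define R where "R = (1 + cmod z) / 2"
  have R: "cmod z < R" "R < 1" "0 < R" using z by (auto simp: R_def intro: add_pos_nonneg)
  have "(cmod (hardy_fun f z))\<^sup>2 \<le> (R + cmod z) / (R - cmod z) * hardy_mean (hardy_fun f) R"
    by (rule hardy_mean_point_evaluation[OF hardy_fun_holomorphic R(1,2)])
  also have "\<dots> \<le> 4 / (1 - cmod z) * (norm f)\<^sup>2"
  proof (rule mult_mono)
    have "(R + cmod z) / (R - cmod z) \<le> 2 / (R - cmod z)"
      using R by (intro divide_right_mono) auto
    also have "\<dots> = 4 / (1 - cmod z)" by (simp add: R_def field_simps)
    finally show "(R + cmod z) / (R - cmod z) \<le> 4 / (1 - cmod z)" .
  qed (use R z hardy_mean_le_norm hardy_mean_nonneg in auto)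
  finally show ?thesis .
qed

text \<open>The cutoff matches the representation in \<open>hardy_set\<close>. The value is
  meaningful for holomorphic \<open>g\<close> with bounded means.\<close>

definition to_hardy :: "(complex \<Rightarrow> complex) \<Rightarrow> hardy2" where
  "to_hardy g = Abs_hardy2 (\<lambda>z. if z \<in> ball 0 1 then g z else 0)"

lemma weighted_comp_eq_to_hardy: "weighted_comp \<psi> \<phi> f = to_hardy (\<lambda>z. \<psi> z * hardy_fun f (\<phi> z))"
  by (simp add: weighted_comp_def to_hardy_def)

lemma
  assumes g: "g holomorphic_on ball 0 1" and C: "0 \<le> C"
    and m: "\<And>r. 0 < r \<Longrightarrow> r < 1 \<Longrightarrow> hardy_mean g r \<le> C\<^sup>2"
  shows hardy_fun_to_hardy: "cmod z < 1 \<Longrightarrow> hardy_fun (to_hardy g) z = g z"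
    and norm_to_hardy_le: "norm (to_hardy g) \<le> C"
proof -
  define h where "h = (\<lambda>z. if z \<in> ball 0 1 then g z else 0)"
  have m': "hardy_mean h r \<le> C\<^sup>2" if r: "0 < r" "r < 1" for r
    using m[OF r] r by (simp add: hardy_mean_def h_def norm_mult)
  have "h holomorphic_on ball 0 1" by (rule holomorphic_transform[OF g]) (simp add: h_def)
  moreover have "bdd_above (hardy_mean h ` {0<..<1})"
    by (rule bdd_aboveI2[where M = "C\<^sup>2"]) (simp add: m')
  ultimately have "h \<in> hardy_set" by (simp add: hardy_set_def h_def)
  then have rep: "hardy_fun (to_hardy g) = h"
    unfolding to_hardy_def h_def[symmetric] by (rule Abs_hardy2_inverse)
  then show "cmod z < 1 \<Longrightarrow> hardy_fun (to_hardy g) z = g z" by (simp add: h_def)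
  show "norm (to_hardy g) \<le> C" by (rule norm_hardy_leI[OF C]) (simp add: rep m')
qed

lemma hardy_mean_mult_bounded_le:
  assumes h: "h holomorphic_on ball 0 1" and f: "f holomorphic_on ball 0 1"
    and M: "\<And>z. cmod z < 1 \<Longrightarrow> cmod (h z) \<le> M" and r: "0 < r" "r < 1"
  shows "hardy_mean (\<lambda>z. h z * f z) r \<le> M\<^sup>2 * hardy_mean f r"
proof -
  have hf: "(\<lambda>z. h z * f z) holomorphic_on ball 0 1" by (intro holomorphic_intros h f)
  have "integral {0..2 * pi} (\<lambda>t. (cmod (h (of_real r * cis t) * f (of_real r * cis t)))\<^sup>2)
      \<le> integral {0..2 * pi} (\<lambda>t. M\<^sup>2 * (cmod (f (of_real r * cis t)))\<^sup>2)"
    using r by (intro integral_le integrable_on_mult_right hardy_mean_integrable(2)[OF hf r]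
        hardy_mean_integrable(2)[OF f r])
      (auto simp: norm_mult power_mult_distrib intro!: mult_right_mono power_mono M)
  from mult_left_mono[OF this, of "1 / (2 * pi)"] show ?thesis by (simp add: hardy_mean_def)
qed

lemma hardy_mean_bounded_le:
  assumes h: "h holomorphic_on ball 0 1" and M: "\<And>z. cmod z < 1 \<Longrightarrow> cmod (h z) \<le> M"
    and r: "0 < r" "r < 1"
  shows "hardy_mean h r \<le> M\<^sup>2"
  using hardy_mean_mult_bounded_le[OF h holomorphic_on_const[of 1] M r] by (simp add: hardy_mean_def)

locale bounded_weighted_comp =
  fixes \<psi> \<phi> :: "complex \<Rightarrow> complex" and M :: real
  assumes \<phi>: "disk_self_map \<phi>" and \<psi>: "\<psi> holomorphic_on ball 0 1"
    and \<psi>_bound: "\<And>z. cmod z < 1 \<Longrightarrow> cmod (\<psi> z) \<le> M"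
begin

lemma \<phi>_hol: "\<phi> holomorphic_on ball 0 1"
  using \<phi> by (simp add: disk_self_map_def)

lemma \<phi>_disk: "cmod z < 1 \<Longrightarrow> cmod (\<phi> z) < 1"
  using \<phi> by (fastforce simp: disk_self_map_def)

lemma comp_hol: "(\<lambda>z. hardy_fun f (\<phi> z)) holomorphic_on ball 0 1"
  by (rule holomorphic_on_compose_gen[OF \<phi>_hol hardy_fun_holomorphic, unfolded o_def])
    (use \<phi>_disk in auto)

text \<open>The image of the closed disk of radius \<open>r\<close> is compact, so subordination
  applies with some \<open>R < 1\<close>. The bound is uniform in \<open>r\<close> because
  \<open>R - cmod (\<phi> 0)\<close> is at least half of \<open>1 - cmod (\<phi> 0)\<close>.\<close>

lemma hardy_mean_comp_le:
  assumes r: "0 < r" "r < 1"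
  shows "hardy_mean (\<lambda>z. hardy_fun f (\<phi> z)) r \<le> 4 / (1 - cmod (\<phi> 0)) * (norm f)\<^sup>2"
proof -
  have "continuous_on (cball 0 r) (\<lambda>z. cmod (\<phi> z))"
    using \<phi>_hol r by (intro continuous_intros holomorphic_on_imp_continuous_on holomorphic_on_subset[OF \<phi>_hol]) auto
  from continuous_attains_sup[OF compact_cball _ this] r obtain z
    where z: "z \<in> cball 0 r" "\<And>y. y \<in> cball 0 r \<Longrightarrow> cmod (\<phi> y) \<le> cmod (\<phi> z)" by force
  define R where "R = (1 + cmod (\<phi> z)) / 2"
  have z1: "cmod (\<phi> z) < 1" using \<phi>_disk[of z] z r by simp
  have 0: "cmod (\<phi> 0) \<le> cmod (\<phi> z)" using z(2)[of 0] r by simp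
  have R: "R < 1" "cmod (\<phi> z) < R" using z1 by (auto simp: R_def)
  have "0 < R" using R(2) norm_ge_zero le_less_trans by blast
  have "hardy_mean (\<lambda>z. hardy_fun f (\<phi> z)) r \<le> (R + cmod (\<phi> 0)) / (R - cmod (\<phi> 0)) * hardy_mean (hardy_fun f) R"
    by (rule hardy_mean_compose_le[OF hardy_fun_holomorphic \<phi>_hol r R(1)])
      (use z(2) R(2) in \<open>auto intro: le_less_trans\<close>)
  also have "\<dots> \<le> 4 / (1 - cmod (\<phi> 0)) * (norm f)\<^sup>2"
  proof (rule mult_mono)
    have "R + cmod (\<phi> 0) \<le> 2" "(1 - cmod (\<phi> 0)) / 2 \<le> R - cmod (\<phi> 0)"
      using 0 z1 by (auto simp: R_def field_simps)
    then have "(R + cmod (\<phi> 0)) / (R - cmod (\<phi> 0)) \<le> 2 / ((1 - cmod (\<phi> 0)) / 2)"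
      using 0 z1 by (intro frac_le) auto
    then show "(R + cmod (\<phi> 0)) / (R - cmod (\<phi> 0)) \<le> 4 / (1 - cmod (\<phi> 0))" by simp
  qed (use R 0 z1 \<open>0 < R\<close> hardy_mean_le_norm hardy_mean_nonneg in auto)
  finally show ?thesis .
qed

text \<open>A bound for the operator norm: \<open>M\<close> accounts for the multiplication, the
  square root of the subordination constant for the composition.\<close>

definition comp_bound :: real where "comp_bound = M * sqrt (4 / (1 - cmod (\<phi> 0)))"

lemma
  shows hardy_fun_weighted_comp:
      "cmod z < 1 \<Longrightarrow> hardy_fun (weighted_comp \<psi> \<phi> f) z = \<psi> z * hardy_fun f (\<phi> z)"
    and norm_weighted_comp_le: "norm (weighted_comp \<psi> \<phi> f) \<le> comp_bound * norm f"
proof -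
  have M: "0 \<le> M" using order_trans[OF norm_ge_zero \<psi>_bound[of 0]] by simp
  have 1: "cmod (\<phi> 0) < 1" using \<phi>_disk[of 0] by simp
  have hol: "(\<lambda>z. \<psi> z * hardy_fun f (\<phi> z)) holomorphic_on ball 0 1"
    by (intro holomorphic_on_mult \<psi> comp_hol)
  have "hardy_mean (\<lambda>z. \<psi> z * hardy_fun f (\<phi> z)) r \<le> (comp_bound * norm f)\<^sup>2" if r: "0 < r" "r < 1" for r
  proof -
    have "hardy_mean (\<lambda>z. \<psi> z * hardy_fun f (\<phi> z)) r \<le> M\<^sup>2 * (4 / (1 - cmod (\<phi> 0)) * (norm f)\<^sup>2)"
      using hardy_mean_mult_bounded_le[OF \<psi> comp_hol \<psi>_bound r, of f]
        mult_left_mono[OF hardy_mean_comp_le[OF r, of f], of "M\<^sup>2"] by simp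
    also have "\<dots> = (comp_bound * norm f)\<^sup>2" using 1 by (simp add: comp_bound_def power_mult_distrib)
    finally show ?thesis .
  qed
  moreover have "0 \<le> comp_bound * norm f" using M 1 by (simp add: comp_bound_def)
  ultimately show "cmod z < 1 \<Longrightarrow> hardy_fun (weighted_comp \<psi> \<phi> f) z = \<psi> z * hardy_fun f (\<phi> z)"
    and "norm (weighted_comp \<psi> \<phi> f) \<le> comp_bound * norm f"
    unfolding weighted_comp_eq_to_hardy
    by (simp_all add: hardy_fun_to_hardy[OF hol] norm_to_hardy_le[OF hol])
qed

lemma bounded_clinear_weighted_comp: "bounded_clinear (weighted_comp \<psi> \<phi>)"
  unfolding bounded_clinear_def
proof (intro conjI allI)
  show "bounded_linear (weighted_comp \<psi> \<phi>)"
  proof (rule bounded_linear_intro[where K = comp_bound])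
    show "norm (weighted_comp \<psi> \<phi> f) \<le> norm f * comp_bound" for f
      using norm_weighted_comp_le by (simp add: mult.commute)
  qed (rule hardy_eqI; simp add: hardy_fun_weighted_comp algebra_simps)+
  show "weighted_comp \<psi> \<phi> (scaleC a f) = scaleC a (weighted_comp \<psi> \<phi> f)" for a f
    by (rule hardy_eqI) (simp add: hardy_fun_weighted_comp)
qed

lemma iterate_disk: "cmod z < 1 \<Longrightarrow> cmod ((\<phi> ^^ n) z) < 1"
  by (induction n) (simp_all add: \<phi>_disk)

lemma hardy_fun_weighted_comp_power:
  "cmod z < 1 \<Longrightarrow> hardy_fun ((weighted_comp \<psi> \<phi> ^^ n) f) z
    = (\<Prod>i<n. \<psi> ((\<phi> ^^ i) z)) * hardy_fun f ((\<phi> ^^ n) z)"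
proof (induction n arbitrary: f)
  case (Suc n)
  have "hardy_fun ((weighted_comp \<psi> \<phi> ^^ Suc n) f) z
      = hardy_fun ((weighted_comp \<psi> \<phi> ^^ n) (weighted_comp \<psi> \<phi> f)) z" by (simp add: funpow_swap1)
  with Suc show ?case by (simp add: hardy_fun_weighted_comp iterate_disk)
qed simp

end

section \<open>Reproducing kernels\<close>

text \<open>The Szego kernel \<open>1 / (1 - cnj a * z)\<close> divided by its norm.\<close>

definition hardy_kernel :: "complex \<Rightarrow> hardy2" where
  "hardy_kernel a = to_hardy (\<lambda>z. of_real (sqrt (1 - (cmod a)\<^sup>2)) / (1 - cnj a * z))"

lemma cnj_mult_neq_1: "cmod a < 1 \<Longrightarrow> cmod z \<le> 1 \<Longrightarrow> cnj a * z \<noteq> 1"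
  by (metis complex_mod_cnj mult_left_le norm_ge_zero norm_mult norm_one not_less)

lemma
  assumes a: "cmod a < 1"
  shows hardy_fun_kernel:
      "cmod z < 1 \<Longrightarrow> hardy_fun (hardy_kernel a) z = of_real (sqrt (1 - (cmod a)\<^sup>2)) / (1 - cnj a * z)"
    and norm_hardy_kernel_le: "norm (hardy_kernel a) \<le> 1"
proof -
  let ?k = "\<lambda>z. of_real (sqrt (1 - (cmod a)\<^sup>2)) / (1 - cnj a * z)"
  have a2: "(cmod a)\<^sup>2 < 1" using a by (simp add: power_less_one_iff abs_square_less_1)
  have hol: "?k holomorphic_on ball 0 1"
    using cnj_mult_neq_1[OF a] by (auto intro!: holomorphic_intros)
  have "hardy_mean ?k r \<le> 1\<^sup>2" if r: "0 < r" "r < 1" for r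
  proof -
    let ?c = "(1 - (cmod a)\<^sup>2) / (1 - (cmod (of_real r * a))\<^sup>2)"
    have "cmod (of_real r * a) \<le> cmod a" using r by (simp add: norm_mult mult_left_le_one_le)
    then have ra: "(cmod (of_real r * a))\<^sup>2 \<le> (cmod a)\<^sup>2" "cmod (of_real r * a) < 1"
      using a by (auto intro: power_mono)
    \<comment> \<open>On the circle of radius \<open>r\<close> the squared modulus is a constant
      multiple of the Poisson kernel at \<open>r a\<close>, whose integral is known.\<close>
    have "(cmod (?k (of_real r * cis t)))\<^sup>2 = ?c * poisson_kernel 1 (of_real r * a) t" for t
    proof -
      have "1 - cnj a * (of_real r * cis t) = cis t * cnj (cis t - of_real r * a)"
        by (simp add: algebra_simps cis_cnj cis_mult)
      then have "cmod (1 - cnj a * (of_real r * cis t)) = cmod (cis t - of_real r * a)"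
        by (simp only: norm_mult complex_mod_cnj norm_cis mult_1)
      then show ?thesis
        using a2 ra le_less_trans[OF ra(1) a2] by (simp add: poisson_kernel_def norm_divide power_divide abs_of_nonneg del: norm_mult)
    qed
    then have "hardy_mean ?k r = ?c"
      using integral_unique[OF poisson_kernel_integral[of 1 "of_real r * a"]] ra
      by (simp add: hardy_mean_def)
    also have "\<dots> \<le> 1" using ra a2 le_less_trans[OF ra(1) a2] by (simp add: divide_le_eq_1)
    finally show ?thesis by simp
  qed
  note mean = this
  show "cmod z < 1 \<Longrightarrow> hardy_fun (hardy_kernel a) z = ?k z"
    unfolding hardy_kernel_def by (rule hardy_fun_to_hardy[OF hol _ mean]) auto
  show "norm (hardy_kernel a) \<le> 1"
    unfolding hardy_kernel_def by (rule norm_to_hardy_le[OF hol _ mean]) auto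
qed

text \<open>The growth matches, up to a constant, the bound in
  \<open>hardy_point_evaluation\<close>. This is what turns evaluations of kernels into lower bounds
  for norms.\<close>

lemma hardy_fun_kernel_diag:
  assumes "cmod a < 1"
  shows "(cmod (hardy_fun (hardy_kernel a) a))\<^sup>2 = 1 / (1 - (cmod a)\<^sup>2)"
proof -
  have a2: "(cmod a)\<^sup>2 < 1" using assms by (simp add: power_less_one_iff abs_square_less_1)
  have "1 - cnj a * a = of_real (1 - (cmod a)\<^sup>2)"
    by (simp add: complex_norm_square mult.commute del: of_real_power)
  then have "hardy_fun (hardy_kernel a) a = of_real (sqrt (1 - (cmod a)\<^sup>2) / (1 - (cmod a)\<^sup>2))"
    by (simp only: hardy_fun_kernel[OF assms assms] of_real_divide)
  then have "(cmod (hardy_fun (hardy_kernel a) a))\<^sup>2 = (sqrt (1 - (cmod a)\<^sup>2) / (1 - (cmod a)\<^sup>2))\<^sup>2"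
    by (simp only: norm_of_real power2_abs)
  then show ?thesis using a2 by (simp add: power_divide power2_eq_square)
qed

lemma bounded_linear_hardy_fun:
  assumes z: "cmod z < 1" shows "bounded_linear (\<lambda>f. hardy_fun f z)"
proof (rule bounded_linear_intro[where K = "sqrt (4 / (1 - cmod z))"])
  fix f
  have "cmod (hardy_fun f z) \<le> sqrt (4 / (1 - cmod z) * (norm f)\<^sup>2)"
    using hardy_point_evaluation[OF z] by (rule real_le_rsqrt)
  also have "\<dots> = norm f * sqrt (4 / (1 - cmod z))"
    by (simp only: real_sqrt_mult real_sqrt_abs abs_norm_cancel mult.commute)
  finally show "cmod (hardy_fun f z) \<le> norm f * sqrt (4 / (1 - cmod z))" .
qed (simp_all add: scaleR_conv_of_real)

text \<open>The normalized kernels tend to zero pointwise as the base point approaches the circle.\<close>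

lemma compact_operator_kernel_not_bounded_below:
  assumes K: "compact_operator K"
    and ev: "\<And>z. cmod z < 1 \<Longrightarrow> \<exists>C v. cmod v < 1 \<and> (\<forall>f. hardy_fun (K f) z = C * hardy_fun f v)"
    and a: "\<And>j. cmod (a j) < 1" "(\<lambda>j. cmod (a j)) \<longlonglongrightarrow> 1" and \<epsilon>: "0 < \<epsilon>"
  shows "\<exists>j. norm (K (hardy_kernel (a j))) < \<epsilon>"
proof (rule ccontr)
  assume "\<not> ?thesis"
  then have ge: "\<epsilon> \<le> norm (K (hardy_kernel (a j)))" for j by (simp add: not_less)
  obtain g r where r: "strict_mono r" and lim: "(\<lambda>j. K (hardy_kernel (a (r j)))) \<longlonglongrightarrow> g"
    by (rule compact_operator_subseq[OF K norm_hardy_kernel_le[OF a(1)]])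
  have ar: "(\<lambda>j. cmod (a (r j))) \<longlonglongrightarrow> 1"
    using LIMSEQ_subseq_LIMSEQ[OF a(2) r] by (simp add: o_def)
  \<comment> \<open>By \<open>ev\<close>, each value of \<open>K (hardy_kernel a)\<close> is a
    multiple of a value of the kernel, with factor and point independent of \<open>a\<close>; these
    values tend to zero.\<close>
  have "g = 0"
  proof (rule hardy_eqI)
    fix z :: complex assume z: "cmod z < 1"
    obtain C v where v: "cmod v < 1" "\<And>f. hardy_fun (K f) z = C * hardy_fun f v" using ev[OF z] by blast
    have "(\<lambda>j. C * hardy_fun (hardy_kernel (a (r j))) v) \<longlonglongrightarrow> 0"
    proof (rule tendsto_mult_right_zero, rule Lim_null_comparison)
      show "\<forall>\<^sub>F j in sequentially. cmod (hardy_fun (hardy_kernel (a (r j))) v)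
          \<le> sqrt (1 - (cmod (a (r j)))\<^sup>2) / (1 - cmod v)"
      proof (intro always_eventually allI)
        fix j
        have "cmod (cnj (a (r j)) * v) \<le> cmod v"
          using a(1)[of "r j"] by (simp add: norm_mult mult_left_le_one_le)
        then have "1 - cmod v \<le> cmod (1 - cnj (a (r j)) * v)"
          using norm_triangle_ineq2[of 1 "cnj (a (r j)) * v"] by simp
        moreover have "(cmod (a (r j)))\<^sup>2 \<le> 1" using a(1)[of "r j"] by (simp add: power_le_one)
        ultimately show "cmod (hardy_fun (hardy_kernel (a (r j))) v)
          \<le> sqrt (1 - (cmod (a (r j)))\<^sup>2) / (1 - cmod v)"
          using v(1) a(1)[of "r j"] by (simp add: hardy_fun_kernel norm_divide) (intro frac_le; simp)
      qed
      have "(\<lambda>j. sqrt (1 - (cmod (a (r j)))\<^sup>2) / (1 - cmod v)) \<longlonglongrightarrow> sqrt (1 - 1\<^sup>2) / (1 - cmod v)"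
        using v(1) by (intro tendsto_intros ar) auto
      then show "(\<lambda>j. sqrt (1 - (cmod (a (r j)))\<^sup>2) / (1 - cmod v)) \<longlonglongrightarrow> 0" by simp
    qed
    moreover have "(\<lambda>j. C * hardy_fun (hardy_kernel (a (r j))) v) \<longlonglongrightarrow> hardy_fun g z"
      using bounded_linear.tendsto[OF bounded_linear_hardy_fun[OF z] lim] by (simp add: v(2))
    ultimately show "hardy_fun g z = hardy_fun 0 z" using LIMSEQ_unique by fastforce
  qed
  with tendsto_norm[OF lim] have "(\<lambda>j. norm (K (hardy_kernel (a (r j))))) \<longlonglongrightarrow> 0" by simp
  from LIMSEQ_le_const[OF this] ge \<epsilon> show False by force
qed

text \<open>On the radius towards \<open>w\<close> the distance to \<open>w\<close> equals the
  distance to the circle, so a Lipschitz estimate at \<open>w\<close> controls the distance of the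
  images to the circle.\<close>

lemma radial_sequence:
  assumes "z = (\<lambda>j. of_real (1 - inverse (real (Suc j))) * w)" "cmod w = 1"
  shows "cmod (z j) < 1" "(\<lambda>j. cmod (z j)) \<longlonglongrightarrow> 1" "cmod (z j - w) = 1 - cmod (z j)"
proof -
  have n: "cmod (z j) = 1 - inverse (real (Suc j))" for j
    using assms by (simp add: norm_mult del: of_real_diff of_real_inverse of_nat_Suc) (simp add: field_simps)
  show "cmod (z j) < 1" by (simp add: n)
  have "(\<lambda>j. 1 - inverse (real (Suc j))) \<longlonglongrightarrow> 1 - 0"
    by (intro tendsto_diff tendsto_const LIMSEQ_inverse_real_of_nat)
  then show lim: "(\<lambda>j. cmod (z j)) \<longlonglongrightarrow> 1" by (simp add: n)
  have "z j - w = of_real (- inverse (real (Suc j))) * w" by (simp add: assms algebra_simps)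
  then show "cmod (z j - w) = 1 - cmod (z j)"
    unfolding n using assms(2) by (simp add: norm_mult norm_inverse del: of_nat_Suc of_real_inverse)
qed

section \<open>Kernel estimates for power compact weighted composition operators\<close>

context bounded_weighted_comp
begin

lemma power_evaluation:
  "cmod z < 1 \<Longrightarrow> \<exists>C v. cmod v < 1 \<and> (\<forall>f. hardy_fun ((weighted_comp \<psi> \<phi> ^^ n) f) z = C * hardy_fun f v)"
  using hardy_fun_weighted_comp_power iterate_disk by blast

lemma zero_in_spectrum:
  assumes "power_compact_operator (weighted_comp \<psi> \<phi>)"
  shows "0 \<in> operator_spectrum (weighted_comp \<psi> \<phi>)"
proof (rule ccontr)
  let ?T = "weighted_comp \<psi> \<phi>"
  assume "0 \<notin> operator_spectrum ?T"
  then obtain S where S: "bounded_clinear S" "S \<circ> ?T = id"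
    by (auto simp: operator_spectrum_def invertible_operator_def)
  obtain n where n: "compact_operator (?T ^^ n)" using assms by (auto simp: power_compact_operator_def)
  have inv: "(S ^^ n) ((?T ^^ n) f) = f" for f
  proof (induction n)
    case (Suc n)
    have "(S ^^ Suc n) ((?T ^^ Suc n) f) = (S ^^ n) ((S \<circ> ?T) ((?T ^^ n) f))"
      by (simp add: funpow_swap1)
    then show ?case using S Suc by simp
  qed simp
  obtain B where B: "0 < B" "\<And>f. norm ((S ^^ n) f) \<le> norm f * B"
    using bounded_linear.pos_bounded bounded_clinear_funpow[OF S(1)] unfolding bounded_clinear_def by metis
  define a where "a = (\<lambda>j. of_real (1 - inverse (real (Suc j))) * (1::complex))"
  note a = radial_sequence[OF a_def norm_one]
  \<comment> \<open>With \<open>3 * B\<close> the squared norm of the kernel is below 1/9, hence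
    below 1/8. The value 1/8 is the threshold, since \<open>1 - |a|^2 \<le> 2 (1 - |a|)\<close> and
    point evaluation costs \<open>4 / (1 - |a|)\<close>.\<close>
  obtain j where j: "norm ((?T ^^ n) (hardy_kernel (a j))) < 1 / (3 * B)"
    using compact_operator_kernel_not_bounded_below[OF n power_evaluation a(1,2), of "1 / (3 * B)"] B by auto
  have "norm (hardy_kernel (a j)) \<le> norm ((?T ^^ n) (hardy_kernel (a j))) * B"
    using B(2)[of "(?T ^^ n) (hardy_kernel (a j))"] by (simp add: inv)
  also have "\<dots> < 1 / (3 * B) * B" using j B by (intro mult_strict_right_mono) auto
  finally have "norm (hardy_kernel (a j)) < 1 / 3" using B by simp
  then have "(norm (hardy_kernel (a j)))\<^sup>2 < (1 / 3)\<^sup>2" by (intro power_strict_mono) auto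
  then have small: "(norm (hardy_kernel (a j)))\<^sup>2 < 1 / 8" by (simp add: power2_eq_square)
  have "1 / (1 - (cmod (a j))\<^sup>2) \<le> 4 / (1 - cmod (a j)) * (norm (hardy_kernel (a j)))\<^sup>2"
    using hardy_point_evaluation[OF a(1)] hardy_fun_kernel_diag[OF a(1)] by metis
  also have "\<dots> < 4 / (1 - cmod (a j)) * (1 / 8)"
    using small a(1)[of j] by (intro mult_strict_left_mono) auto
  also have "\<dots> \<le> 1 / (1 - (cmod (a j))\<^sup>2)"
  proof -
    have "1 - (cmod (a j))\<^sup>2 = (1 - cmod (a j)) * (1 + cmod (a j))"
      by (simp add: power2_eq_square algebra_simps)
    also have "\<dots> \<le> (1 - cmod (a j)) * 2" using a(1)[of j] by (intro mult_left_mono) auto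
    finally have *: "1 - (cmod (a j))\<^sup>2 \<le> (1 - cmod (a j)) * 2" .
    have "(cmod (a j))\<^sup>2 < 1" using a(1)[of j] by (simp add: abs_square_less_1)
    with * have "1 / ((1 - cmod (a j)) * 2) \<le> 1 / (1 - (cmod (a j))\<^sup>2)" by (intro frac_le) auto
    moreover have "4 / x * (1 / 8) = 1 / (x * 2)" for x :: real by simp
    ultimately show ?thesis by (simp only:)
  qed
  finally show False by simp
qed

lemma not_power_compact_boundary_fixpoint:
  assumes low: "0 < \<delta>" "\<And>z. cmod z < 1 \<Longrightarrow> \<delta> \<le> cmod (\<psi> z)"
    and lip: "L-lipschitz_on (cball 0 1) \<phi>" and w: "\<phi> w = w" "cmod w = 1"
  shows "\<not> power_compact_operator (weighted_comp \<psi> \<phi>)"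
proof
  let ?T = "weighted_comp \<psi> \<phi>"
  assume "power_compact_operator ?T"
  then obtain n where n: "compact_operator (?T ^^ n)" by (auto simp: power_compact_operator_def)
  \<comment> \<open>Using \<open>L + 1\<close> in place of \<open>L\<close> keeps \<open>B\<close>
    positive even if \<open>L = 0\<close>.\<close>
  define B where "B = (L + 1) ^ n"
  have L: "0 \<le> L" by (rule lipschitz_on_nonneg[OF lip])
  then have B: "0 < B" by (simp add: B_def)
  have iter: "cmod ((\<phi> ^^ m) z - w) \<le> (L + 1) ^ m * cmod (z - w)" if z: "cmod z < 1" for z m
  proof (induction m)
    case (Suc m)
    have "cmod (\<phi> ((\<phi> ^^ m) z) - \<phi> w) \<le> L * cmod ((\<phi> ^^ m) z - w)"
      using lipschitz_onD[OF lip, of "(\<phi> ^^ m) z" w] iterate_disk[OF z, of m] w(2) by (simp add: dist_norm)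
    also have "\<dots> \<le> (L + 1) * ((L + 1) ^ m * cmod (z - w))"
      using L Suc by (intro mult_mono) auto
    finally show ?case using w by (simp add: mult.assoc)
  qed simp
  define z where "z = (\<lambda>j. of_real (1 - inverse (real (Suc j))) * w)"
  note z = radial_sequence[OF z_def w(2)]
  define a where "a = (\<lambda>j. (\<phi> ^^ n) (z j))"
  have a1: "cmod (a j) < 1" for j unfolding a_def by (rule iterate_disk[OF z(1)])
  \<comment> \<open>The distance of \<open>a j\<close> to the circle is at most its distance to
    \<open>w\<close>, which is at most \<open>B\<close> times that of \<open>z j\<close>.\<close>
  have aw: "1 - cmod (a j) \<le> B * (1 - cmod (z j))" for j
    using iter[OF z(1), of n j] norm_triangle_ineq2[of w "a j"] norm_minus_commute[of w "a j"] w(2)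
    unfolding z(3) B_def a_def by linarith
  have "(\<lambda>j. cmod (a j)) \<longlonglongrightarrow> 1"
  proof (rule tendsto_sandwich)
    show "\<forall>\<^sub>F j in sequentially. 1 - B * (1 - cmod (z j)) \<le> cmod (a j)"
      using aw by (intro always_eventually allI) (simp add: algebra_simps)
    show "\<forall>\<^sub>F j in sequentially. cmod (a j) \<le> 1"
      using a1 by (intro always_eventually allI less_imp_le)
    have "(\<lambda>j. 1 - B * (1 - cmod (z j))) \<longlonglongrightarrow> 1 - B * (1 - 1)" by (intro tendsto_intros z(2))
    then show "(\<lambda>j. 1 - B * (1 - cmod (z j))) \<longlonglongrightarrow> 1" by simp
  qed simp
  \<comment> \<open>The constant balances two estimates: point evaluation at \<open>z j\<close>
    contributes 4, and \<open>1 - |a|^2 \<le> 2 B (1 - |z|)\<close> leaves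
    \<open>8 * B\<close>.\<close>
  from compact_operator_kernel_not_bounded_below[OF n power_evaluation a1 this, of "sqrt ((\<delta> ^ n)\<^sup>2 / (8 * B))"]
  obtain j where "norm ((?T ^^ n) (hardy_kernel (a j))) < sqrt ((\<delta> ^ n)\<^sup>2 / (8 * B))"
    using B low(1) by auto
  then have "(norm ((?T ^^ n) (hardy_kernel (a j))))\<^sup>2 < (sqrt ((\<delta> ^ n)\<^sup>2 / (8 * B)))\<^sup>2"
    by (intro power_strict_mono) auto
  then have small: "(norm ((?T ^^ n) (hardy_kernel (a j))))\<^sup>2 < (\<delta> ^ n)\<^sup>2 / (8 * B)"
    using B by simp
  have zj: "0 < 1 - cmod (z j)" using z(1)[of j] by simp
  have aj: "0 < 1 - (cmod (a j))\<^sup>2" using a1[of j] by (simp add: abs_square_less_1)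
  have "1 - (cmod (a j))\<^sup>2 = (1 - cmod (a j)) * (1 + cmod (a j))"
    by (simp add: power2_eq_square algebra_simps)
  also have "\<dots> \<le> (B * (1 - cmod (z j))) * 2"
    using a1[of j] aw[of j] B zj by (intro mult_mono) auto
  finally have aB: "1 - (cmod (a j))\<^sup>2 \<le> 2 * B * (1 - cmod (z j))" by simp
  have "(\<Prod>i<n. \<delta>) \<le> (\<Prod>i<n. cmod (\<psi> ((\<phi> ^^ i) (z j))))"
    using low iterate_disk[OF z(1)] by (intro prod_mono) (auto intro: less_imp_le)
  then have "\<delta> ^ n \<le> cmod (\<Prod>i<n. \<psi> ((\<phi> ^^ i) (z j)))" by (simp add: prod_norm)
  then have "(\<delta> ^ n)\<^sup>2 * (1 / (1 - (cmod (a j))\<^sup>2))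
      \<le> (cmod (\<Prod>i<n. \<psi> ((\<phi> ^^ i) (z j))))\<^sup>2 * (1 / (1 - (cmod (a j))\<^sup>2))"
    using aj low(1) by (intro mult_right_mono power_mono) auto
  also have "\<dots> = (cmod (hardy_fun ((?T ^^ n) (hardy_kernel (a j))) (z j)))\<^sup>2"
    by (simp only: hardy_fun_weighted_comp_power[OF z(1)] norm_mult power_mult_distrib
        hardy_fun_kernel_diag[OF a1, unfolded a_def] a_def)
  also have "\<dots> \<le> 4 / (1 - cmod (z j)) * (norm ((?T ^^ n) (hardy_kernel (a j))))\<^sup>2"
    by (rule hardy_point_evaluation[OF z(1)])
  also have "\<dots> < 4 / (1 - cmod (z j)) * ((\<delta> ^ n)\<^sup>2 / (8 * B))"
    using small zj by (intro mult_strict_left_mono) auto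
  also have "\<dots> = (\<delta> ^ n)\<^sup>2 * (1 / (2 * B * (1 - cmod (z j))))" by simp
  also have "\<dots> \<le> (\<delta> ^ n)\<^sup>2 * (1 / (1 - (cmod (a j))\<^sup>2))"
    using aj aB by (intro mult_left_mono frac_le) auto
  finally show False by simp
qed

end

section \<open>The spectrum at an interior fixed point\<close>

context bounded_weighted_comp
begin

text \<open>Here \<open>k\<close> is the order of vanishing of \<open>f\<close> at \<open>w\<close> and \<open>c\<close> its leading coefficient.\<close>

lemma leading_coefficient:
  assumes w: "\<phi> w = w" "cmod w < 1" and f: "f \<noteq> 0"
  shows "\<exists>k c. c \<noteq> 0 \<and> ((\<lambda>z. hardy_fun (weighted_comp \<psi> \<phi> f - scaleC \<mu> f) z / (z - w) ^ k)
    \<longlongrightarrow> (\<psi> w * deriv \<phi> w ^ k - \<mu>) * c) (at w)"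
proof -
  have nz: "\<exists>z\<in>ball 0 1. hardy_fun f z \<noteq> 0"
    by (metis f hardy_eqI hardy_fun_linear(1) mem_ball_0)
  define k where "k = nat (zorder (hardy_fun f) w)"
  define g where "g = zor_poly (hardy_fun f) w"
  have "w \<in> ball 0 1" using w by simp
  from zorder_exist_zero[OF hardy_fun_holomorphic open_ball connected_ball this nz, folded k_def g_def]
  obtain r where r: "0 < r" "cball w r \<subseteq> ball 0 1" and g: "g holomorphic_on cball w r"
    and fg: "\<And>z. z \<in> cball w r \<Longrightarrow> hardy_fun f z = g z * (z - w) ^ k \<and> g z \<noteq> 0"
    by blast
  have "continuous_on (ball w r) g"
    by (meson g ball_subset_cball continuous_on_subset holomorphic_on_imp_continuous_on)
  then have "isCont g w" using r by (simp add: continuous_on_eq_continuous_at)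
  have cont: "isCont \<phi> w" "isCont \<psi> w"
    using holomorphic_on_imp_continuous_on[OF \<phi>_hol] holomorphic_on_imp_continuous_on[OF \<psi>] w
    by (simp_all add: continuous_on_eq_continuous_at)
  then have \<phi>lim: "(\<phi> \<longlongrightarrow> w) (at w)" and \<psi>lim: "(\<psi> \<longlongrightarrow> \<psi> w) (at w)" using w by (simp_all add: isCont_def)
  have glim: "(g \<longlongrightarrow> g w) (at w)" using \<open>isCont g w\<close> by (simp add: isCont_def)
  have g\<phi>: "((\<lambda>z. g (\<phi> z)) \<longlongrightarrow> g w) (at w)"
    using isCont_tendsto_compose[OF \<open>isCont g w\<close> \<phi>lim] .
  have "(\<phi> has_field_derivative deriv \<phi> w) (at w)"
    by (rule holomorphic_derivI[OF \<phi>_hol open_ball]) (use w in simp)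
  then have dlim: "((\<lambda>z. (\<phi> z - w) / (z - w)) \<longlongrightarrow> deriv \<phi> w) (at w)"
    using w by (simp add: has_field_derivative_iff)
  \<comment> \<open>Writing \<open>f = g (z - w)^k\<close>, the composition divided by
    \<open>(z - w)^k\<close> is \<open>g (\<phi> z)\<close> times the \<open>k\<close>-th power of
    the difference quotient of \<open>\<phi>\<close> at \<open>w\<close>.\<close>
  have "((\<lambda>z. \<psi> z * (g (\<phi> z) * ((\<phi> z - w) / (z - w)) ^ k) - \<mu> * g z)
      \<longlongrightarrow> \<psi> w * (g w * deriv \<phi> w ^ k) - \<mu> * g w) (at w)"
    by (intro tendsto_intros \<psi>lim g\<phi> dlim glim)
  moreover have "\<forall>\<^sub>F z in at w. \<psi> z * (g (\<phi> z) * ((\<phi> z - w) / (z - w)) ^ k) - \<mu> * g z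
      = hardy_fun (weighted_comp \<psi> \<phi> f - scaleC \<mu> f) z / (z - w) ^ k"
  proof -
    have "\<forall>\<^sub>F z in at w. \<phi> z \<in> ball w r"
      using topological_tendstoD[OF \<phi>lim open_ball, of w r] r by simp
    moreover have "\<forall>\<^sub>F z in at w. z \<in> ball w r - {w}"
      by (rule eventually_at_in_open[OF open_ball]) (use r in simp)
    ultimately show ?thesis
    proof eventually_elim
      case (elim z)
      then have z: "z \<in> cball w r" "\<phi> z \<in> cball w r" "z \<noteq> w" by auto
      with r have "cmod z < 1" by auto
      with fg[OF z(1)] fg[OF z(2)] z(3) show ?case
        by (simp add: hardy_fun_weighted_comp power_divide field_simps)
    qed
  qed
  ultimately have "((\<lambda>z. hardy_fun (weighted_comp \<psi> \<phi> f - scaleC \<mu> f) z / (z - w) ^ k)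
      \<longlongrightarrow> \<psi> w * (g w * deriv \<phi> w ^ k) - \<mu> * g w) (at w)"
    by (rule Lim_transform_eventually)
  moreover have "g w \<noteq> 0" using fg[of w] r by simp
  moreover have "\<psi> w * (g w * deriv \<phi> w ^ k) - \<mu> * g w = (\<psi> w * deriv \<phi> w ^ k - \<mu>) * g w"
    by (simp add: algebra_simps)
  ultimately show ?thesis by metis
qed

text \<open>For an eigenvector the limit in \<open>leading_coefficient\<close> is that of the zero
  function, while \<open>c\<close> is nonzero.\<close>

lemma eigenvalue_at_fixpoint:
  assumes w: "\<phi> w = w" "cmod w < 1" and f: "f \<noteq> 0" "weighted_comp \<psi> \<phi> f = scaleC \<mu> f"
  shows "\<exists>k. \<mu> = \<psi> w * deriv \<phi> w ^ k"
proof -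
  obtain k c where c: "c \<noteq> 0" "((\<lambda>z. hardy_fun (weighted_comp \<psi> \<phi> f - scaleC \<mu> f) z / (z - w) ^ k)
    \<longlongrightarrow> (\<psi> w * deriv \<phi> w ^ k - \<mu>) * c) (at w)"
    using leading_coefficient[OF w f(1)] by blast
  then have "((\<lambda>z::complex. 0::complex) \<longlongrightarrow> (\<psi> w * deriv \<phi> w ^ k - \<mu>) * c) (at w)" by (simp add: f(2))
  then have "(\<psi> w * deriv \<phi> w ^ k - \<mu>) * c = 0" by (simp add: tendsto_const_iff)
  with c show ?thesis by auto
qed

text \<open>For the least exponent \<open>l\<close> that yields the value \<open>\<mu>\<close>, comparing orders of vanishing at \<open>w\<close>
  shows that \<open>(z - w) ^ l\<close> is not in the range of \<open>T - \<mu>\<close>.\<close>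

lemma fixpoint_value_in_spectrum:
  assumes w: "\<phi> w = w" "cmod w < 1"
  shows "\<psi> w * deriv \<phi> w ^ m \<in> operator_spectrum (weighted_comp \<psi> \<phi>)"
proof (rule ccontr)
  define \<mu> where "\<mu> = \<psi> w * deriv \<phi> w ^ m"
  let ?P = "\<lambda>i. \<psi> w * deriv \<phi> w ^ i = \<mu>"
  \<comment> \<open>Different exponents may give the same value, for instance if the derivative is
    zero or a root of unity.\<close>
  define l where "l = (LEAST i. ?P i)"
  have l: "?P l" unfolding l_def by (rule LeastI[of _ m]) (simp add: \<mu>_def)
  have less: "l \<le> k" if "?P k" for k unfolding l_def using that by (rule Least_le)
  assume "\<psi> w * deriv \<phi> w ^ m \<notin> operator_spectrum (weighted_comp \<psi> \<phi>)"
  then have surj: "\<exists>f. weighted_comp \<psi> \<phi> f - scaleC \<mu> f = h" for h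
    by (simp add: operator_spectrum_def invertible_operator_def \<mu>_def[symmetric]) (metis comp_apply id_apply)
  have hol: "(\<lambda>z. (z - w) ^ l) holomorphic_on ball 0 1" by (intro holomorphic_intros)
  have bound: "hardy_mean (\<lambda>z. (z - w) ^ l) r \<le> (2 ^ l)\<^sup>2" if "0 < r" "r < 1" for r
  proof (rule hardy_mean_bounded_le[OF hol _ that])
    fix z :: complex assume "cmod z < 1"
    then have "cmod (z - w) \<le> 2" using norm_triangle_ineq4[of z w] w by simp
    then show "cmod ((z - w) ^ l) \<le> 2 ^ l" by (simp add: norm_power power_mono)
  qed
  obtain f where f: "weighted_comp \<psi> \<phi> f - scaleC \<mu> f = to_hardy (\<lambda>z. (z - w) ^ l)" using surj by blast
  have fz: "hardy_fun (weighted_comp \<psi> \<phi> f - scaleC \<mu> f) z = (z - w) ^ l" if "cmod z < 1" for z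
    unfolding f by (rule hardy_fun_to_hardy[OF hol _ bound that]) auto
  have ev: "\<forall>\<^sub>F z in at w. z \<in> ball 0 1 - {w}"
    by (rule eventually_at_in_open[OF open_ball]) (use w in simp)
  have "f \<noteq> 0"
  proof
    assume "f = 0"
    obtain z where "z \<in> ball 0 1 - {w}" using eventually_happens[OF ev] by auto
    with fz[of z] \<open>f = 0\<close> show False by (simp add: hardy_fun_weighted_comp)
  qed
  then obtain k c where c: "c \<noteq> 0" and
    lim: "((\<lambda>z. hardy_fun (weighted_comp \<psi> \<phi> f - scaleC \<mu> f) z / (z - w) ^ k)
      \<longlongrightarrow> (\<psi> w * deriv \<phi> w ^ k - \<mu>) * c) (at w)"
    using leading_coefficient[OF w] by blast
  have id: "((\<lambda>z. z - w) \<longlongrightarrow> 0) (at w)" by (intro tendsto_eq_intros) auto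
  show False
  proof (cases "l \<le> k")
    \<comment> \<open>Multiplied by \<open>(z - w)^(k - l)\<close> the quotient is constantly 1. Its
      limit is zero, by the power of \<open>z - w\<close> if \<open>l < k\<close> and by the choice
      of \<open>l\<close> if \<open>l = k\<close>.\<close>
    case True
    have "((\<lambda>z. (z - w) ^ (k - l) * (hardy_fun (weighted_comp \<psi> \<phi> f - scaleC \<mu> f) z / (z - w) ^ k))
        \<longlongrightarrow> 0 ^ (k - l) * ((\<psi> w * deriv \<phi> w ^ k - \<mu>) * c)) (at w)"
      by (intro tendsto_mult tendsto_power id lim)
    moreover have "\<forall>\<^sub>F z in at w. (z - w) ^ (k - l) *
        (hardy_fun (weighted_comp \<psi> \<phi> f - scaleC \<mu> f) z / (z - w) ^ k) = 1"
      using ev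
    proof eventually_elim
      case (elim z)
      then have "(z - w) ^ (k - l) * ((z - w) ^ l / (z - w) ^ k) = 1"
        using True by (simp flip: power_add)
      with elim show ?case by (simp only: fz mem_ball_0 Diff_iff)
    qed
    ultimately have "((\<lambda>z. 1) \<longlongrightarrow> 0 ^ (k - l) * ((\<psi> w * deriv \<phi> w ^ k - \<mu>) * c)) (at w)"
      by (rule Lim_transform_eventually)
    then have "0 ^ (k - l) * ((\<psi> w * deriv \<phi> w ^ k - \<mu>) * c) = 1" by (simp add: tendsto_const_iff)
    then show False using True l by (cases "k = l") (simp_all add: zero_power)
  next
    \<comment> \<open>Here the quotient is a positive power of \<open>z - w\<close>, so its limit is
      zero and \<open>k\<close> yields \<open>\<mu>\<close>, against minimality of
      \<open>l\<close>.\<close>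
    case False
    have "((\<lambda>z. (z - w) ^ (l - k)) \<longlongrightarrow> 0 ^ (l - k)) (at w)" by (intro tendsto_power id)
    moreover have "\<forall>\<^sub>F z in at w. (z - w) ^ (l - k)
        = hardy_fun (weighted_comp \<psi> \<phi> f - scaleC \<mu> f) z / (z - w) ^ k"
      using ev
    proof eventually_elim
      case (elim z)
      then have "(z - w) ^ (l - k) = (z - w) ^ l / (z - w) ^ k"
        using False by (simp add: power_diff)
      with elim show ?case by (simp only: fz mem_ball_0 Diff_iff)
    qed
    ultimately have "((\<lambda>z. hardy_fun (weighted_comp \<psi> \<phi> f - scaleC \<mu> f) z / (z - w) ^ k)
        \<longlongrightarrow> 0 ^ (l - k)) (at w)" by (rule Lim_transform_eventually)
    then have "0 ^ (l - k) = (\<psi> w * deriv \<phi> w ^ k - \<mu>) * c" using lim by (rule tendsto_unique[rotated]) simp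
    with False c have "?P k" by (simp add: zero_power)
    with less False show False by blast
  qed
qed

text \<open>The iterates fix \<open>w\<close> and stay in the disk, so Cauchy's inequality bounds
  all powers of the derivative by one constant. Hence the spectral radius is attained at
  \<open>m = 0\<close>.\<close>

lemma deriv_fixpoint_le_1:
  assumes w: "\<phi> w = w" "cmod w < 1"
  shows "cmod (deriv \<phi> w) \<le> 1"
proof (rule ccontr)
  assume gt: "\<not> ?thesis"
  have d: "(\<phi> has_field_derivative deriv \<phi> w) (at w)"
    by (rule holomorphic_derivI[OF \<phi>_hol open_ball]) (use w in simp)
  have iter_w: "(\<phi> ^^ n) w = w" for n by (induction n) (simp_all add: w)
  have dn: "((\<phi> ^^ n) has_field_derivative deriv \<phi> w ^ n) (at w)" for n
  proof (induction n)
    case (Suc n)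
    from DERIV_chain[of \<phi> "deriv \<phi> w" "\<phi> ^^ n" w, unfolded iter_w, OF d Suc] show ?case by (simp add: o_def)
  qed (simp add: id_def)
  have hol: "(\<phi> ^^ n) holomorphic_on ball 0 1" for n
  proof (induction n)
    case (Suc n)
    have "\<phi> \<circ> (\<phi> ^^ n) holomorphic_on ball 0 1"
      by (rule holomorphic_on_compose_gen[OF Suc \<phi>_hol]) (auto simp: iterate_disk)
    then show ?case by (simp add: o_def)
  qed (simp add: id_def)
  define \<rho> where "\<rho> = (1 - cmod w) / 2"
  have \<rho>: "0 < \<rho>" using w by (simp add: \<rho>_def)
  have sub: "cball w \<rho> \<subseteq> ball 0 1"
  proof
    fix z assume "z \<in> cball w \<rho>"
    then show "z \<in> ball 0 1"
      using norm_triangle_sub[of z w] w by (simp add: \<rho>_def dist_norm norm_minus_commute field_simps)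
  qed
  have "cmod (deriv \<phi> w) ^ n \<le> 1 / \<rho>" for n
  proof -
    have "(\<phi> ^^ n) holomorphic_on cball w \<rho>" by (rule holomorphic_on_subset[OF hol sub])
    then have "cmod ((deriv ^^ 1) (\<phi> ^^ n) w) \<le> fact 1 * 1 / \<rho> ^ 1"
    proof (intro Cauchy_inequality \<rho>)
      fix z assume "cmod (w - z) = \<rho>"
      then have "z \<in> cball w \<rho>" by (simp add: dist_norm)
      with sub have "cmod z < 1" by auto
      then show "cmod ((\<phi> ^^ n) z) \<le> 1" using iterate_disk less_imp_le by blast
    qed (auto intro: holomorphic_on_imp_continuous_on holomorphic_on_subset)
    then show ?thesis by (simp add: DERIV_imp_deriv[OF dn] norm_power)
  qed
  moreover obtain n where "1 / \<rho> < cmod (deriv \<phi> w) ^ n" using real_arch_pow gt by force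
  ultimately show False by (simp add: not_le[symmetric])
qed

lemma spectrum_power_compact_fixpoint:
  assumes pc: "power_compact_operator (weighted_comp \<psi> \<phi>)" and w: "\<phi> w = w" "cmod w < 1"
  shows "operator_spectrum (weighted_comp \<psi> \<phi>) = {\<psi> w * deriv \<phi> w ^ m | m :: nat. True} \<union> {0}"
    and "operator_spectral_radius (weighted_comp \<psi> \<phi>) = cmod (\<psi> w)"
proof -
  show spec: "operator_spectrum (weighted_comp \<psi> \<phi>) = {\<psi> w * deriv \<phi> w ^ m | m :: nat. True} \<union> {0}"
  proof (intro equalityI subsetI)
    fix \<mu> assume \<mu>: "\<mu> \<in> operator_spectrum (weighted_comp \<psi> \<phi>)"
    show "\<mu> \<in> {\<psi> w * deriv \<phi> w ^ m | m :: nat. True} \<union> {0}"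
    proof (cases "\<mu> = 0")
      case False
      then obtain f where "f \<noteq> 0" "weighted_comp \<psi> \<phi> f = scaleC \<mu> f"
        using power_compact_spectrum_eigenvalue[OF bounded_clinear_weighted_comp pc \<mu>] by blast
      from eigenvalue_at_fixpoint[OF w this] show ?thesis by blast
    qed simp
  qed (use fixpoint_value_in_spectrum[OF w] zero_in_spectrum[OF pc] in blast)
  have "cmod \<mu> \<le> cmod (\<psi> w)" if "\<mu> \<in> operator_spectrum (weighted_comp \<psi> \<phi>)" for \<mu>
    using that deriv_fixpoint_le_1[OF w]
    by (auto simp: spec norm_mult norm_power intro!: mult_left_le power_le_one)
  moreover have "\<psi> w \<in> operator_spectrum (weighted_comp \<psi> \<phi>)"
    using fixpoint_value_in_spectrum[OF w, of 0] by simp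
  ultimately show "operator_spectral_radius (weighted_comp \<psi> \<phi>) = cmod (\<psi> w)"
    unfolding operator_spectral_radius_def by (intro cSup_eq_maximum) auto
qed

end

text \<open>This serves the case \<open>b = 0\<close>, where the weight has no positive lower bound
  and the fixed point may lie on the circle.\<close>

lemma spectrum_zero_weight:
  assumes pc: "power_compact_operator (weighted_comp (\<lambda>_. 0) \<phi>)" and \<phi>: "disk_self_map \<phi>"
  shows "operator_spectrum (weighted_comp (\<lambda>_. 0) \<phi>) = {0}"
proof -
  interpret bounded_weighted_comp "\<lambda>_. 0" \<phi> 0 by standard (simp_all add: \<phi>)
  have T0: "weighted_comp (\<lambda>_. 0) \<phi> f = 0" for f
    by (rule hardy_eqI) (simp add: hardy_fun_weighted_comp)
  have "\<mu> = 0" if \<mu>: "\<mu> \<in> operator_spectrum (weighted_comp (\<lambda>_. 0) \<phi>)" for \<mu>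
  proof (rule ccontr)
    assume "\<mu> \<noteq> 0"
    from power_compact_spectrum_eigenvalue[OF bounded_clinear_weighted_comp pc \<mu> this]
    obtain f where "f \<noteq> 0" and f: "weighted_comp (\<lambda>_. 0) \<phi> f = scaleC \<mu> f" by blast
    have "scaleC \<mu> f = 0" using f[symmetric] unfolding T0 .
    then have "cmod \<mu> * norm f = 0" by (simp flip: norm_scaleC)
    with \<open>f \<noteq> 0\<close> \<open>\<mu> \<noteq> 0\<close> show False by simp
  qed
  with zero_in_spectrum[OF pc] show ?thesis by blast
qed

section \<open>The linear fractional symbols\<close>

lemma one_minus_mult_bounds:
  assumes "cmod q < 1" "cmod z \<le> 1"
  shows "1 - cmod q \<le> cmod (1 - q * z)" "cmod (1 - q * z) \<le> 2"
proof -
  have *: "cmod (q * z) \<le> cmod q" using assms by (simp add: norm_mult mult_left_le)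
  show "1 - cmod q \<le> cmod (1 - q * z)" using norm_triangle_ineq2[of 1 "q * z"] * by simp
  show "cmod (1 - q * z) \<le> 2" using norm_triangle_ineq4[of 1 "q * z"] * assms by simp
qed

text \<open>The difference of two values is \<open>(B + A * q) * (z - u)\<close>, with the
  determinant of the map as coefficient, over two denominators of modulus at least
  \<open>1 - cmod q\<close>.\<close>

lemma mobius_lipschitz:
  assumes q: "cmod q < 1"
  shows "(cmod (B + A * q) / (1 - cmod q)\<^sup>2)-lipschitz_on (cball 0 1) (\<lambda>z. (A + B * z) / (1 - q * z))"
proof (rule lipschitz_onI)
  fix z u :: complex assume "z \<in> cball 0 1" "u \<in> cball 0 1"
  then have b: "1 - cmod q \<le> cmod (1 - q * z)" "1 - cmod q \<le> cmod (1 - q * u)"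
    using one_minus_mult_bounds(1)[OF q] by auto
  then have ne: "1 - q * z \<noteq> 0" "1 - q * u \<noteq> 0" using q by auto
  have "(A + B * z) / (1 - q * z) - (A + B * u) / (1 - q * u)
      = (B + A * q) * (z - u) / ((1 - q * z) * (1 - q * u))"
    using ne by (simp add: diff_frac_eq) (simp add: algebra_simps)
  moreover have "(1 - cmod q)\<^sup>2 \<le> cmod ((1 - q * z) * (1 - q * u))"
    unfolding norm_mult power2_eq_square using b q by (intro mult_mono) auto
  ultimately show "dist ((A + B * z) / (1 - q * z)) ((A + B * u) / (1 - q * u))
      \<le> cmod (B + A * q) / (1 - cmod q)\<^sup>2 * dist z u"
    using q by (simp add: dist_norm norm_divide norm_mult[of "B + A * q"]) (rule frac_le; simp)
qed simp


text \<open>Apply \<open>\<phi>\<close> to the orbit of 0 and pass to the limit. Continuity on the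
  closed disk covers a limit point on the circle.\<close>

lemma denjoy_wolff_fixpoint:
  assumes dw: "denjoy_wolff_point \<phi> w" and cont: "continuous_on (cball 0 1) \<phi>"
  shows "\<phi> w = w"
proof -
  have w: "w \<in> cball 0 1" and self: "disk_self_map \<phi>"
    using dw by (auto simp: denjoy_wolff_point_def)
  have lim0: "(\<lambda>n. (\<phi> ^^ n) 0) \<longlonglongrightarrow> w"
    using dw[unfolded denjoy_wolff_point_def, THEN conjunct2, THEN conjunct2, rule_format, of "{0}"] by simp
  have "(\<phi> ^^ n) 0 \<in> ball 0 1" for n
  proof (induction n)
    case (Suc n)
    then show ?case using self by (auto simp: disk_self_map_def simp del: mem_ball_0 mem_ball)
  qed simp
  then have "\<forall>n. (\<phi> ^^ n) 0 \<in> cball 0 1" using ball_subset_cball by blast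
  from continuous_on_tendsto_compose[OF cont lim0 w] this
  have "(\<lambda>n. (\<phi> ^^ Suc n) 0) \<longlonglongrightarrow> \<phi> w" by simp
  from LIMSEQ_unique[OF this LIMSEQ_Suc[OF lim0]] show ?thesis .
qed

theorem theorem3p4:
  fixes a0 a1 b p c w :: complex
    and \<psi> \<phi> \<psi>p \<phi>p \<psi>t \<phi>t :: "complex \<Rightarrow> complex"
  assumes "a0 \<in> ball 0 1"
    and "\<psi> = (\<lambda>z. b / (1 - a0 * z))"
    and "\<phi> = (\<lambda>z. a0 + a1 * z / (1 - a0 * z))"
    and "disk_self_map \<phi>"
    and "p \<in> ball 0 1 - {0}"
    and "cmod c = 1"
    and "\<phi>p = (\<lambda>z. cnj p / p * ((p - z) / (1 - cnj p * z)))"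
    and "\<psi>p = (\<lambda>z. c * (complex_of_real (sqrt (1 - (cmod p)\<^sup>2)) / (1 - cnj p * z)))"
    and "\<psi>t = (\<lambda>z. \<psi>p z * \<psi> (\<phi>p z))"
    and "\<phi>t = \<phi> \<circ> \<phi>p"
    and "compact_operator (weighted_comp \<psi>t \<phi>t) \<or> power_compact_operator (weighted_comp \<psi>t \<phi>t)"
    and "denjoy_wolff_point \<phi>t w"
  shows "operator_spectral_radius (weighted_comp \<psi>t \<phi>t) = cmod (\<psi>p w * \<psi> (\<phi>p w)) \<and>
    operator_spectrum (weighted_comp \<psi>t \<phi>t) =
      {\<psi>p w * \<psi> (\<phi>p w) * (deriv \<phi>t w) ^ m | m :: nat. True} \<union> {0}"
proof -
  have p: "cmod p < 1" "p \<noteq> 0" and a0: "cmod a0 < 1" using assms(1,5) by auto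
  have self: "disk_self_map \<phi>t" and w: "cmod w \<le> 1"
    using assms(12) by (auto simp: denjoy_wolff_point_def)
  have "compact_operator T \<Longrightarrow> power_compact_operator T" for T :: "hardy2 \<Rightarrow> hardy2"
    unfolding power_compact_operator_def by (rule exI[of _ 1]) simp
  with assms(11) have pc: "power_compact_operator (weighted_comp \<psi>t \<phi>t)" by blast
  have \<psi>t: "\<psi>p w * \<psi> (\<phi>p w) = \<psi>t w" by (simp add: assms(9))
  have \<phi>p_le: "cmod (\<phi>p z) \<le> 1" if z: "cmod z \<le> 1" for z
  proof -
    have "(cmod (1 - cnj p * z))\<^sup>2 - (cmod (p - z))\<^sup>2 = (1 - (cmod p)\<^sup>2) * (1 - (cmod z)\<^sup>2)"
      unfolding cmod_power2 by (simp add: power2_eq_square algebra_simps)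
    moreover have "0 \<le> (1 - (cmod p)\<^sup>2) * (1 - (cmod z)\<^sup>2)"
      using p z by (intro mult_nonneg_nonneg) (simp_all add: power_le_one)
    ultimately have "cmod (p - z) \<le> cmod (1 - cnj p * z)"
      by (intro power2_le_imp_le[OF _ norm_ge_zero]) linarith
    moreover have "1 - cnj p * z \<noteq> 0" using cnj_mult_neq_1[OF p(1) z] by simp
    ultimately show ?thesis using p by (simp add: assms(7) norm_mult norm_divide)
  qed
  have den: "1 - cmod a0 \<le> cmod (1 - a0 * \<phi>p z)" "cmod (1 - a0 * \<phi>p z) \<le> 2"
    "1 - cmod p \<le> cmod (1 - cnj p * z)" "cmod (1 - cnj p * z) \<le> 2" if "cmod z \<le> 1" for z
    using one_minus_mult_bounds[OF a0 \<phi>p_le[OF that]] one_minus_mult_bounds[of "cnj p" z] p that by auto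
  define s where "s = sqrt (1 - (cmod p)\<^sup>2)"
  have s: "0 < s" "s \<le> 1" using p(1) by (simp_all add: s_def abs_square_less_1)
  \<comment> \<open>With \<open>den\<close> this gives both the upper bound for the locale and the
    lower bound that excludes boundary fixed points.\<close>
  have norm_\<psi>t: "cmod (\<psi>t z) = s / cmod (1 - cnj p * z) * (cmod b / cmod (1 - a0 * \<phi>p z))" for z
    using s(1) assms(6) unfolding assms(9,8,2) s_def[symmetric] by (simp add: norm_mult norm_divide)
  interpret bounded_weighted_comp \<psi>t \<phi>t "1 / (1 - cmod p) * (cmod b / (1 - cmod a0))"
  proof
    show "disk_self_map \<phi>t" by (rule self)
    have ne: "1 - cnj p * z \<noteq> 0" "1 - a0 * \<phi>p z \<noteq> 0" if "z \<in> ball 0 1" for z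
      using den(1,3)[of z] that p a0 by auto
    have "\<phi>p holomorphic_on ball 0 1"
      unfolding assms(7) using ne p by (intro holomorphic_intros) auto
    then show "\<psi>t holomorphic_on ball 0 1"
      unfolding assms(9,8,2) using ne by (intro holomorphic_intros) auto
    fix z :: complex assume "cmod z < 1"
    then show "cmod (\<psi>t z) \<le> 1 / (1 - cmod p) * (cmod b / (1 - cmod a0))"
      unfolding norm_\<psi>t using den[of z] s p a0 by (intro mult_mono frac_le) auto
  qed
  obtain L where L: "L-lipschitz_on (cball 0 1) \<phi>t"
  proof
    \<comment> \<open>Both factors of \<open>\<phi>t\<close> are brought to the form
      \<open>(A + B * z) / (1 - q * z)\<close>, so that each is Lipschitz on the closed
      disk.\<close>
    have eq: "\<phi>p = (\<lambda>z. (cnj p + (- (cnj p / p)) * z) / (1 - cnj p * z))"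
      using p by (auto simp: assms(7) fun_eq_iff field_simps)
    have 1: "(cmod (- (cnj p / p) + cnj p * cnj p) / (1 - cmod (cnj p))\<^sup>2)-lipschitz_on (cball 0 1) \<phi>p"
      unfolding eq by (rule mobius_lipschitz) (use p in simp)
    have "\<phi> z = (a0 + (a1 - a0 * a0) * z) / (1 - a0 * z)" if "z \<in> cball 0 1" for z
    proof -
      have "1 - a0 * z \<noteq> 0" using one_minus_mult_bounds(1)[OF a0, of z] a0 that by auto
      then show ?thesis by (simp add: assms(3) field_simps)
    qed
    with mobius_lipschitz[OF a0, of "a1 - a0 * a0" a0]
    have "(cmod (a1 - a0 * a0 + a0 * a0) / (1 - cmod a0)\<^sup>2)-lipschitz_on (cball 0 1) \<phi>"
      by (subst lipschitz_on_cong[OF refl refl]) auto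
    then have 2: "(cmod (a1 - a0 * a0 + a0 * a0) / (1 - cmod a0)\<^sup>2)-lipschitz_on (\<phi>p ` cball 0 1) \<phi>"
      by (rule lipschitz_on_subset) (auto intro: \<phi>p_le)
    show "(cmod (a1 - a0 * a0 + a0 * a0) / (1 - cmod a0)\<^sup>2
        * (cmod (- (cnj p / p) + cnj p * cnj p) / (1 - cmod (cnj p))\<^sup>2))-lipschitz_on (cball 0 1) \<phi>t"
      unfolding assms(10) by (rule lipschitz_on_compose[OF 1 2])
  qed
  have fix_w: "\<phi>t w = w"
    by (rule denjoy_wolff_fixpoint[OF assms(12) lipschitz_on_continuous_on[OF L]])
  show ?thesis
  proof (cases "b = 0")
    case True
    then have "\<psi>t = (\<lambda>_. 0)" by (simp add: assms(9,2))
    \<comment> \<open>The claimed set collapses to \<open>{0}\<close> wherever \<open>w\<close>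
      lies, since \<open>\<psi>t w = 0\<close>.\<close>
    then show ?thesis
      using spectrum_zero_weight[OF _ self] pc by (auto simp: \<psi>t operator_spectral_radius_def)
  next
    case False
    have "cmod w < 1"
    proof (rule ccontr)
      assume "\<not> cmod w < 1"
      with w have "cmod w = 1" by simp
      \<comment> \<open>Each of the two denominators has modulus at most 2.\<close>
      moreover have "s / 2 * (cmod b / 2) \<le> cmod (\<psi>t z)" if "cmod z < 1" for z
        unfolding norm_\<psi>t using den[of z] that s p a0
        by (intro mult_mono divide_left_mono mult_pos_pos divide_nonneg_nonneg) (auto intro: less_le_trans)
      moreover have "0 < s / 2 * (cmod b / 2)" using s False by simp
      ultimately show False
        using not_power_compact_boundary_fixpoint[OF _ _ L fix_w] pc by blast
    qed
    with spectrum_power_compact_fixpoint[OF pc fix_w] show ?thesis by (simp only: \<psi>t)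
  qed
qed

end
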